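(* There is an absolute constant $C>0$ such that the following holds. Let $n\in\mathbb{N}$, $\delta\in(0,1]$, $c\in(0,1]$ with $n\ge C\sqrt{\log\frac{1}{\delta c}}$, and let $\mathcal{O}_k:\mathbb{C}^{k\times k}\to\mathbb{C}$ for $1\le k\le n$ be oracles such that for every $k\le n$ and every $X\in\mathbb{C}^{k\times k}$, $|\mathcal{O}_k(X)-\mathrm{Per}_k(X)|^2\le\delta^2 k!$. Then $\mathsf{PTest}$ (with parameters $n,\delta,c$ and oracle access to $\{\mathcal{O}_k\}$) accepts with probability at least $1-c$.
   Context: For a $k\times k$ complex matrix $X=(x_{i,j})$, $\mathrm{Per}_k(X)=\sum_{\pi}\prod_{i=1}^k x_{i,\pi(i)}$ over permutations $\pi$ of $[k]$. The Gaussian ensemble on $\mathbb{C}^{k\times k}$: entries i.i.d. standard complex Gaussians ($\mathbb{E}|x|^2=1$). For $X\in\mathbb{C}^{k\times k}$, $x_{11},\dots,x_{1k}$ are the first-row entries and $X_i$ is the minor obtained by deleting the first row and $i$-th column. $\mathsf{LinearityTest}(n,k,\delta)$: sample Gaussian $X\in\mathbb{C}^{k\times k}$; if $k=1$ output Reject unless $|\mathcal{O}_1(X)-X|^2\le n^2\delta^2$; if $k\ge2$ output Reject unless $|\mathcal{O}_k(X)-\sum_{i=1}^k x_{1i}\mathcal{O}_{k-1}(X_i)|^2\le n^2\delta^2k!$. $\mathsf{TailTest}(k,T)$: sample Gaussian $X\in\mathbb{C}^{k\times k}$; output Reject unless $|\mathcal{O}_k(X)|^2\le T^2k!$. $\mathsf{PTest}$: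 set $T=\frac{4n}{\delta\sqrt c}$, $d=\frac{192n^2}{\delta^4c}$; for each $1\le k\le n$ run $\mathsf{LinearityTest}(n,k,\delta)$ $d$ times and $\mathsf{TailTest}(k,T)$ $d$ times with independent samples; output Accept iff none outputs Reject. *)

theory Defs
  imports "HOL-Probability.Probability"
begin

text \<open>
  A \<open>k \<times> k\<close> complex matrix is a function on index pairs, indexed from 1 and extensional:
  it is \<open>undefined\<close> outside \<open>{1..k} \<times> {1..k}\<close>. In this way \<open>k\<close> can be an ordinary variable,
  and \<open>cmatrices k\<close> is the space of the product measure below.
\<close>

type_synonym cmatrix = "nat \<times> nat \<Rightarrow> complex"

definition cmatrices :: "nat \<Rightarrow> cmatrix set" where
  "cmatrices k = ({1..k} \<times> {1..k}) \<rightarrow>\<^sub>E UNIV"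

definition permanent :: "nat \<Rightarrow> cmatrix \<Rightarrow> complex" where
  "permanent k X = (\<Sum>\<pi> | \<pi> permutes {1..k}. \<Prod>i=1..k. X (i, \<pi> i))"

definition minor :: "nat \<Rightarrow> cmatrix \<Rightarrow> nat \<Rightarrow> cmatrix" where
  "minor k X m =
     (\<lambda>(i, j) \<in> {1..k - 1} \<times> {1..k - 1}. X (i + 1, if j < m then j else j + 1))"

text \<open>
  The standard complex Gaussian has independent real and imaginary parts of variance \<open>1/2\<close> each
  (the second parameter of \<^const>\<open>normal_density\<close> is the standard deviation).
\<close>

definition real_gaussian_half :: "real measure" where
  "real_gaussian_half = density lborel (normal_density 0 (sqrt (1 / 2)))"

definition std_complex_gaussian :: "complex measure" where
  "std_complex_gaussian =
     distr (real_gaussian_half \<Otimes>\<^sub>M real_gaussian_half) borel (\<lambda>(a, b). Complex a b)"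

definition gaussian_ensemble :: "nat \<Rightarrow> cmatrix measure" where
  "gaussian_ensemble k = (\<Pi>\<^sub>M ij \<in> {1..k} \<times> {1..k}. std_complex_gaussian)"

datatype verdict = Accept | Reject

text \<open>
  The tests are functions of the sampled matrix \<open>X\<close>; the randomness is supplied by
  \<open>PTest_space\<close> below. The family of oracles is \<open>\<O>\<close>, with \<open>\<O> k\<close> the oracle for
  \<open>k \<times> k\<close> matrices.
\<close>

definition LinearityTest ::
  "(nat \<Rightarrow> cmatrix \<Rightarrow> complex) \<Rightarrow> nat \<Rightarrow> nat \<Rightarrow> real \<Rightarrow> cmatrix \<Rightarrow> verdict" where
  "LinearityTest \<O> n k \<delta> X =
     (if k = 1 then
        (if (cmod (\<O> 1 X - X (1, 1)))\<^sup>2 \<le> (real n)\<^sup>2 * \<delta>\<^sup>2 then Accept else Reject)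
      else
        (if (cmod (\<O> k X - (\<Sum>i=1..k. X (1, i) * \<O> (k - 1) (minor k X i))))\<^sup>2
              \<le> (real n)\<^sup>2 * \<delta>\<^sup>2 * fact k then Accept else Reject))"

definition TailTest ::
  "(nat \<Rightarrow> cmatrix \<Rightarrow> complex) \<Rightarrow> nat \<Rightarrow> real \<Rightarrow> cmatrix \<Rightarrow> verdict" where
  "TailTest \<O> k T X = (if (cmod (\<O> k X))\<^sup>2 \<le> T\<^sup>2 * fact k then Accept else Reject)"

definition PTest_threshold :: "nat \<Rightarrow> real \<Rightarrow> real \<Rightarrow> real" where
  "PTest_threshold n \<delta> c = 4 * real n / (\<delta> * sqrt c)"

text \<open>The number of repetitions \<open>192 n\<^sup>2 / (\<delta>\<^sup>4 c)\<close> need not be an integer; it is rounded up.\<close>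

definition PTest_reps :: "nat \<Rightarrow> real \<Rightarrow> real \<Rightarrow> nat" where
  "PTest_reps n \<delta> c = nat \<lceil>192 * (real n)\<^sup>2 / (\<delta> ^ 4 * c)\<rceil>"

datatype test_kind = Linearity | Tail

text \<open>
  The index \<open>(t, k, r)\<close> denotes the \<open>r\<close>-th run of test \<open>t\<close> in dimension \<open>k\<close>. Each run has its own
  sample, and all samples are independent.
\<close>

definition PTest_runs :: "nat \<Rightarrow> real \<Rightarrow> real \<Rightarrow> (test_kind \<times> nat \<times> nat) set" where
  "PTest_runs n \<delta> c = UNIV \<times> {1..n} \<times> {1..PTest_reps n \<delta> c}"

definition PTest_space ::
  "nat \<Rightarrow> real \<Rightarrow> real \<Rightarrow> (test_kind \<times> nat \<times> nat \<Rightarrow> cmatrix) measure" where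
  "PTest_space n \<delta> c = (\<Pi>\<^sub>M (t, k, r) \<in> PTest_runs n \<delta> c. gaussian_ensemble k)"

definition PTest ::
  "(nat \<Rightarrow> cmatrix \<Rightarrow> complex) \<Rightarrow> nat \<Rightarrow> real \<Rightarrow> real
     \<Rightarrow> (test_kind \<times> nat \<times> nat \<Rightarrow> cmatrix) \<Rightarrow> verdict" where
  "PTest \<O> n \<delta> c \<omega> =
     (if \<exists>k\<in>{1..n}. \<exists>r\<in>{1..PTest_reps n \<delta> c}.
           LinearityTest \<O> n k \<delta> (\<omega> (Linearity, k, r)) = Reject \<or>
           TailTest \<O> k (PTest_threshold n \<delta> c) (\<omega> (Tail, k, r)) = Reject
      then Reject else Accept)"

text \<open>
  The oracles are arbitrary functions, so the acceptance event need not be measurable, and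
  \<^const>\<open>measure\<close> would give a non-measurable event the value 0. Its probability is therefore
  taken to be its inner probability. The lemmas below show that this is the ordinary
  probability when the event is measurable, in particular for measurable oracles.
\<close>

definition inner_prob :: "'a measure \<Rightarrow> 'a set \<Rightarrow> real" where
  "inner_prob M A = (SUP E \<in> {E \<in> sets M. E \<subseteq> A}. measure M E)"

definition PTest_accept_prob ::
  "(nat \<Rightarrow> cmatrix \<Rightarrow> complex) \<Rightarrow> nat \<Rightarrow> real \<Rightarrow> real \<Rightarrow> real" where
  "PTest_accept_prob \<O> n \<delta> c =
     inner_prob (PTest_space n \<delta> c) {\<omega> \<in> space (PTest_space n \<delta> c). PTest \<O> n \<delta> c \<omega> = Accept}"

lemma (in finite_measure) inner_prob_eq_measure:
  assumes "A \<in> sets M"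
  shows "inner_prob M A = measure M A"
  unfolding inner_prob_def
proof (rule cSup_eq_maximum)
  show "measure M A \<in> measure M ` {E \<in> sets M. E \<subseteq> A}"
    using assms by auto
  show "x \<le> measure M A" if "x \<in> measure M ` {E \<in> sets M. E \<subseteq> A}" for x
    using that assms by (auto intro: finite_measure_mono)
qed

lemma prob_space_std_complex_gaussian: "prob_space std_complex_gaussian"
proof -
  interpret G: prob_space real_gaussian_half
    unfolding real_gaussian_half_def by (rule prob_space_normal_density) simp
  interpret P: pair_prob_space real_gaussian_half real_gaussian_half ..
  have [measurable_cong]: "sets real_gaussian_half = sets borel"
    by (simp add: real_gaussian_half_def)
  have "(\<lambda>(a, b). Complex a b) = (\<lambda>(a, b). complex_of_real a + \<i> * complex_of_real b)"
    by (auto simp: complex_eq_iff)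
  then have "(\<lambda>(a, b). Complex a b) \<in> real_gaussian_half \<Otimes>\<^sub>M real_gaussian_half \<rightarrow>\<^sub>M borel"
    by simp
  then show ?thesis
    unfolding std_complex_gaussian_def by (rule P.prob_space_distr)
qed

lemma sets_std_complex_gaussian [measurable_cong]: "sets std_complex_gaussian = sets borel"
  by (simp add: std_complex_gaussian_def)

lemma space_std_complex_gaussian: "space std_complex_gaussian = UNIV"
  by (simp add: std_complex_gaussian_def)

lemma space_gaussian_ensemble: "space (gaussian_ensemble k) = cmatrices k"
  by (simp add: gaussian_ensemble_def cmatrices_def space_PiM space_std_complex_gaussian)

lemma prob_space_gaussian_ensemble: "prob_space (gaussian_ensemble k)"
  unfolding gaussian_ensemble_def by (intro prob_space_PiM prob_space_std_complex_gaussian)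

lemma prob_space_PTest_space: "prob_space (PTest_space n \<delta> c)"
  unfolding PTest_space_def
  by (intro prob_space_PiM) (auto intro: prob_space_gaussian_ensemble)

lemma measurable_entry:
  assumes "i \<in> {1..k}" "j \<in> {1..k}"
  shows "(\<lambda>X. X (i, j)) \<in> borel_measurable (gaussian_ensemble k)"
proof -
  have "(\<lambda>X. X (i, j)) \<in> gaussian_ensemble k \<rightarrow>\<^sub>M std_complex_gaussian"
    unfolding gaussian_ensemble_def using assms by (intro measurable_component_singleton) auto
  then show ?thesis
    by (simp cong: measurable_cong_sets add: sets_std_complex_gaussian)
qed

lemma measurable_minor:
  assumes "m \<in> {1..k}"
  shows "(\<lambda>X. minor k X m) \<in> gaussian_ensemble k \<rightarrow>\<^sub>M gaussian_ensemble (k - 1)"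
proof -
  have "(\<lambda>X. minor k X m) \<in> gaussian_ensemble k \<rightarrow>\<^sub>M
      (\<Pi>\<^sub>M ij \<in> {1..k - 1} \<times> {1..k - 1}. std_complex_gaussian)"
    unfolding minor_def
  proof (rule measurable_restrict)
    fix ij :: "nat \<times> nat"
    assume ij: "ij \<in> {1..k - 1} \<times> {1..k - 1}"
    obtain i j where [simp]: "ij = (i, j)" by fastforce
    have "(\<lambda>X. X (i + 1, if j < m then j else j + 1)) \<in> borel_measurable (gaussian_ensemble k)"
      using ij by (intro measurable_entry) auto
    then show "(\<lambda>X. case ij of (i, j) \<Rightarrow> X (i + 1, if j < m then j else j + 1))
        \<in> gaussian_ensemble k \<rightarrow>\<^sub>M std_complex_gaussian"
      by (simp cong: measurable_cong_sets add: sets_std_complex_gaussian)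
  qed
  then show ?thesis
    by (simp add: gaussian_ensemble_def)
qed

lemma PTest_accept_prob_eq_measure:
  assumes meas: "\<And>k. k \<in> {1..n} \<Longrightarrow> \<O> k \<in> borel_measurable (gaussian_ensemble k)"
  shows "PTest_accept_prob \<O> n \<delta> c =
    measure (PTest_space n \<delta> c) {\<omega> \<in> space (PTest_space n \<delta> c). PTest \<O> n \<delta> c \<omega> = Accept}"
proof -
  let ?M = "PTest_space n \<delta> c"
  interpret prob_space ?M by (rule prob_space_PTest_space)
  have run: "(\<lambda>\<omega>. \<omega> (t, k, r)) \<in> ?M \<rightarrow>\<^sub>M gaussian_ensemble k"
    if "k \<in> {1..n}" "r \<in> {1..PTest_reps n \<delta> c}" for t k r
  proof -
    have "(\<lambda>\<omega>. \<omega> (t, k, r)) \<in> ?M \<rightarrow>\<^sub>M (case (t, k, r) of (t, k, r) \<Rightarrow> gaussian_ensemble k)"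
      unfolding PTest_space_def
      using that by (intro measurable_component_singleton) (auto simp: PTest_runs_def)
    then show ?thesis by simp
  qed
  have lin: "Measurable.pred (gaussian_ensemble k) (\<lambda>X. LinearityTest \<O> n k \<delta> X = Reject)"
    if k: "k \<in> {1..n}" for k
  proof (cases "k = 1")
    case True
    have [measurable]: "\<O> (Suc 0) \<in> borel_measurable (gaussian_ensemble k)"
      using meas[OF k] True by simp
    have [measurable]: "(\<lambda>X. X (Suc 0, Suc 0)) \<in> borel_measurable (gaussian_ensemble k)"
      using measurable_entry[of 1 k 1] True by simp
    have "Measurable.pred (gaussian_ensemble k)
        (\<lambda>X. \<not> (cmod (\<O> (Suc 0) X - X (Suc 0, Suc 0)))\<^sup>2 \<le> (real n)\<^sup>2 * \<delta>\<^sup>2)"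
      by measurable
    then show ?thesis
      using True by (simp add: LinearityTest_def)
  next
    case False
    have [measurable]: "\<O> k \<in> borel_measurable (gaussian_ensemble k)"
      using meas[OF k] .
    have [measurable]: "(\<lambda>X. \<Sum>i=1..k. X (1, i) * \<O> (k - 1) (minor k X i))
        \<in> borel_measurable (gaussian_ensemble k)"
    proof (intro borel_measurable_sum borel_measurable_times)
      fix i assume i: "i \<in> {1..k}"
      show "(\<lambda>X. X (1, i)) \<in> borel_measurable (gaussian_ensemble k)"
        using i k by (intro measurable_entry) auto
      have "\<O> (k - 1) \<in> borel_measurable (gaussian_ensemble (k - 1))"
        using k False by (intro meas) auto
      then show "(\<lambda>X. \<O> (k - 1) (minor k X i)) \<in> borel_measurable (gaussian_ensemble k)"
        using measurable_compose[OF measurable_minor[OF i]] by blast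
    qed
    have "Measurable.pred (gaussian_ensemble k) (\<lambda>X. \<not>
        (cmod (\<O> k X - (\<Sum>i=1..k. X (1, i) * \<O> (k - 1) (minor k X i))))\<^sup>2
          \<le> (real n)\<^sup>2 * \<delta>\<^sup>2 * fact k)"
      by measurable
    then show ?thesis
      using False by (simp add: LinearityTest_def)
  qed
  have tail: "Measurable.pred (gaussian_ensemble k) (\<lambda>X. TailTest \<O> k T X = Reject)"
    if k: "k \<in> {1..n}" for k T
  proof -
    have [measurable]: "\<O> k \<in> borel_measurable (gaussian_ensemble k)"
      using meas[OF k] .
    show ?thesis by (simp add: TailTest_def)
  qed
  have "Measurable.pred ?M (\<lambda>\<omega>. \<not> (\<exists>k\<in>{1..n}. \<exists>r\<in>{1..PTest_reps n \<delta> c}.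
      LinearityTest \<O> n k \<delta> (\<omega> (Linearity, k, r)) = Reject \<or>
      TailTest \<O> k (PTest_threshold n \<delta> c) (\<omega> (Tail, k, r)) = Reject))"
    by (intro pred_intros_logic pred_intros_finite finite_atLeastAtMost
        measurable_compose[OF run lin] measurable_compose[OF run tail])
  then have "Measurable.pred ?M (\<lambda>\<omega>. PTest \<O> n \<delta> c \<omega> = Accept)"
    by (simp add: PTest_def)
  then have "{\<omega> \<in> space ?M. PTest \<O> n \<delta> c \<omega> = Accept} \<in> sets ?M"
    by (simp add: pred_def)
  then show ?thesis
    unfolding PTest_accept_prob_def by (rule inner_prob_eq_measure)
qed

end

theory Submission
  imports Defs "HOL-Real_Asymp.Real_Asymp"
begin

text \<open>
  Expanding the permanent along the first row, a linearity test can only reject if the first row of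
  its sample has squared norm larger than \<open>(n - 1)\<^sup>2\<close>, which has probability at most
  \<open>2\<^sup>k exp (- (n - 1)\<^sup>2 / 2)\<close>. A tail test can only reject if \<open>|Per X| > (T - 1) sqrt (k!)\<close>. The second
  moment of the permanent is too weak to survive the union bound over all repetitions, but the fourth
  moment \<open>E |Per X|\<^sup>4 \<le> (k + 1) (k!)\<^sup>2\<close> is strong enough: the tail tests fail with probability at most
  \<open>3 c / 4\<close> for large \<open>n\<close>.

  For small \<open>n\<close> these bounds say nothing. There one uses that \<open>C\<close> may be huge, so that
  \<open>1 - c \<le> ln (1 / (\<delta> c)) \<le> n\<^sup>2 / C\<^sup>2\<close> is tiny, whereas the test accepts with a fixed positive
  probability, namely whenever all sampled entries are at most \<open>1 / n\<close> in absolute value.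
\<close>

subsection \<open>Permanents and permutations\<close>

text \<open>Each dimension has about \<open>192 n^2 / (\<delta>^4 c)\<close> tail tests and
  \<open>T^2 = 16 n^2 / (\<delta>^2 c)\<close>. Second moments therefore bound the expected number
  of tail failures only by about \<open>12 n / \<delta>^2\<close>. With fourth moments, the sum of
  \<open>(k + 1) / T^4\<close> over \<open>k\<close> is about
  \<open>\<delta>^4 c^2 / (512 n^2)\<close>, so \<open>n\<close> and \<open>\<delta>\<close> cancel
  and about \<open>3 c / 8\<close> remains. The linearity tests are where large \<open>n\<close>
  uses the relation between \<open>n\<close> and \<open>\<delta> c\<close>: the factor
  \<open>1 / (\<delta>^4 c)\<close> in the number of runs has to be beaten by a Gaussian tail in
  \<open>n\<close>.

  Since the oracles are arbitrary, acceptance itself may fail to be measurable. Every lower bound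
  therefore goes through an event inside it that speaks only of entries, row norms and permanents of
  the samples.

  The choice of \<open>C\<close> is not circular: the dimension from which the asymptotic estimates
  hold is the same for all \<open>C \<ge> 4\<close>, so it can be fixed first, and \<open>C\<close>
  then has to serve only finitely many smaller dimensions.\<close>

definition skip :: "nat \<Rightarrow> nat \<Rightarrow> nat" where
  "skip m j = (if j < m then j else j + 1)"

lemma inj_skip: "inj (skip m)"
  by (auto simp: inj_def skip_def split: if_splits)

lemma skip_neq [simp]: "skip m j \<noteq> m"
  by (auto simp: skip_def)

text \<open>Inverts the deletion of the first row: row 1 is sent to column \<open>m\<close>, and the
  other rows follow \<open>\<sigma>\<close> with the columns renumbered by \<open>skip m\<close> to
  avoid \<open>m\<close>, exactly as in \<open>minor\<close>. The last branch is the identity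
  because \<open>permutes\<close> demands it off the index set.\<close>

definition insert_row :: "nat \<Rightarrow> nat \<times> (nat \<Rightarrow> nat) \<Rightarrow> nat \<Rightarrow> nat" where
  "insert_row k = (\<lambda>(m, \<sigma>) i. if i = 1 then m else if i \<in> {2..Suc k} then skip m (\<sigma> (i - 1)) else i)"

lemma insert_row_permutes:
  assumes m: "m \<in> {1..Suc k}" and \<sigma>: "\<sigma> permutes {1..k}"
  shows "insert_row k (m, \<sigma>) permutes {1..Suc k}"
proof (rule bij_imp_permutes)
  let ?p = "insert_row k (m, \<sigma>)"
  have inj: "inj_on ?p {1..Suc k}"
  proof (rule inj_onI)
    fix x y assume xy: "x \<in> {1..Suc k}" "y \<in> {1..Suc k}" "?p x = ?p y"
    have "\<sigma> (x - 1) = \<sigma> (y - 1)" if "x \<noteq> 1" "y \<noteq> 1"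
      using xy that injD[OF inj_skip] by (auto simp: insert_row_def)
    then have "x - 1 = y - 1" if "x \<noteq> 1" "y \<noteq> 1"
      using that permutes_inj[OF \<sigma>] by (auto dest: injD)
    then show "x = y"
      using xy skip_neq[of m] skip_neq[of m, symmetric] by (auto simp: insert_row_def split: if_splits)
  qed
  have "?p ` {1..Suc k} \<subseteq> {1..Suc k}"
  proof safe
    fix x assume x: "x \<in> {1..Suc k}"
    have "\<sigma> (x - 1) \<in> {1..k}" if "x \<noteq> 1"
      using x that by (subst permutes_in_image[OF \<sigma>]) auto
    then show "?p x \<in> {1..Suc k}"
      using x m by (auto simp: insert_row_def skip_def)
  qed
  then show "bij_betw ?p {1..Suc k} {1..Suc k}"
    using inj by (simp add: bij_betw_def endo_inj_surj)
  show "?p x = x" if "x \<notin> {1..Suc k}" for x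
    using that by (auto simp: insert_row_def)
qed

lemma bij_betw_insert_row:
  "bij_betw (insert_row k) ({1..Suc k} \<times> {\<sigma>. \<sigma> permutes {1..k}}) {\<pi>. \<pi> permutes {1..Suc k}}"
proof -
  let ?D = "{1..Suc k} \<times> {\<sigma>. \<sigma> permutes {1..k}}"
  have inj: "inj_on (insert_row k) ?D"
  proof (rule inj_onI, clarify)
    fix m \<sigma> m' \<sigma>'
    assume \<sigma>: "\<sigma> permutes {1..k}" "\<sigma>' permutes {1..k}" and eq: "insert_row k (m, \<sigma>) = insert_row k (m', \<sigma>')"
    have m: "m = m'"
      using fun_cong[OF eq, of 1] by (simp add: insert_row_def)
    have "\<sigma> x = \<sigma>' x" for x
    proof (cases "x \<in> {1..k}")
      case True
      then show ?thesis
        using fun_cong[OF eq, of "Suc x"] m by (auto simp: insert_row_def dest: injD[OF inj_skip])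
    next
      case False
      then show ?thesis
        using \<sigma> by (simp add: permutes_def)
    qed
    with m show "m = m' \<and> \<sigma> = \<sigma>'" by auto
  qed
  \<comment> \<open>Surjectivity by counting instead of by an inverse: both sides have
    \<open>(k + 1) * k! = (k + 1)!\<close> elements.\<close>
  have "insert_row k ` ?D = {\<pi>. \<pi> permutes {1..Suc k}}"
  proof (rule card_subset_eq)
    show "finite {\<pi>. \<pi> permutes {1..Suc k}}"
      by (simp add: finite_permutations)
    show "insert_row k ` ?D \<subseteq> {\<pi>. \<pi> permutes {1..Suc k}}"
      using insert_row_permutes by auto
    show "card (insert_row k ` ?D) = card {\<pi>. \<pi> permutes {1..Suc k}}"
      unfolding card_image[OF inj]
      by (simp add: card_cartesian_product card_permutations[OF refl])
  qed
  with inj show ?thesis by (simp add: bij_betw_def)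
qed

text \<open>Permutations are grouped by their value at row 1. This is the identity that
  \<open>LinearityTest\<close> probes; for \<open>k = 1\<close> it remains true because the empty
  permanent is 1.\<close>

lemma permanent_expand_first_row:
  assumes "k \<ge> 1"
  shows "permanent k X = (\<Sum>m=1..k. X (1, m) * permanent (k - 1) (minor k X m))"
proof -
  obtain k' where k: "k = Suc k'"
    using assms by (cases k) auto
  have "permanent k X = (\<Sum>(m, \<sigma>)\<in>{1..k} \<times> {\<sigma>. \<sigma> permutes {1..k'}}. \<Prod>i=1..k. X (i, insert_row k' (m, \<sigma>) i))"
    unfolding permanent_def k
    by (subst sum.reindex_bij_betw[OF bij_betw_insert_row, symmetric]) (simp add: case_prod_unfold)
  also have "\<dots> = (\<Sum>(m, \<sigma>)\<in>{1..k} \<times> {\<sigma>. \<sigma> permutes {1..k'}}. X (1, m) * (\<Prod>i=1..k'. minor k X m (i, \<sigma> i)))"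
  proof (rule sum.cong[OF refl], clarify)
    fix m \<sigma> assume \<sigma>: "\<sigma> permutes {1..k'}"
    have "(\<Prod>i=1..k. X (i, insert_row k' (m, \<sigma>) i))
        = X (1, m) * (\<Prod>i=Suc 1..Suc k'. X (i, insert_row k' (m, \<sigma>) i))"
      unfolding k by (subst prod.atLeast_Suc_atMost) (auto simp: insert_row_def)
    also have "(\<Prod>i=Suc 1..Suc k'. X (i, insert_row k' (m, \<sigma>) i))
        = (\<Prod>i=1..k'. X (Suc i, insert_row k' (m, \<sigma>) (Suc i)))"
      by (subst prod.atLeast_Suc_atMost_Suc_shift) (simp add: o_def)
    also have "\<dots> = (\<Prod>i=1..k'. minor k X m (i, \<sigma> i))"
    proof (rule prod.cong[OF refl])
      fix i assume i: "i \<in> {1..k'}"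
      then have "\<sigma> i \<in> {1..k'}"
        using permutes_in_image[OF \<sigma>] by blast
      with i show "X (Suc i, insert_row k' (m, \<sigma>) (Suc i)) = minor k X m (i, \<sigma> i)"
        by (auto simp: insert_row_def minor_def k skip_def)
    qed
    finally show "(\<Prod>i=1..k. X (i, insert_row k' (m, \<sigma>) i)) = X (1, m) * (\<Prod>i=1..k'. minor k X m (i, \<sigma> i))" .
  qed
  also have "\<dots> = (\<Sum>m=1..k. X (1, m) * permanent (k - 1) (minor k X m))"
    by (simp add: permanent_def k sum_distrib_left sum.cartesian_product)
  finally show ?thesis .
qed

section \<open>Counting permutations by their image of a set\<close>

text \<open>A permutation of \<open>A\<close> that preserves \<open>S\<close> also preserves
  \<open>A - S\<close>, so it is determined by its two restrictions, each extended by the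
  identity.\<close>

lemma card_permutes_stabilizer_le:
  assumes "finite A" "S \<subseteq> A"
  shows "card {q. q permutes A \<and> q ` S = S} \<le> fact (card S) * fact (card A - card S)"
proof -
  let ?f = "\<lambda>q. (\<lambda>x. if x \<in> S then q x else x, \<lambda>x. if x \<in> S then x else q x)"
  have "card {q. q permutes A \<and> q ` S = S} \<le> card ({p. p permutes S} \<times> {p. p permutes (A - S)})"
  proof (rule card_inj_on_le)
    show "inj_on ?f {q. q permutes A \<and> q ` S = S}"
    proof (rule inj_onI, rule ext)
      fix q q' x assume eq: "?f q = ?f q'"
      show "q x = q' x"
        using eq by (cases "x \<in> S") (auto dest: fun_cong[of _ _ x])
    qed
    show "?f ` {q. q permutes A \<and> q ` S = S} \<subseteq> {p. p permutes S} \<times> {p. p permutes (A - S)}"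
    proof (rule image_subsetI)
      fix q assume "q \<in> {q. q permutes A \<and> q ` S = S}"
      then have q: "q permutes A" "q ` S = S" by auto
      have inj: "inj q" using q(1) by (rule permutes_inj)
      have "q ` (A - S) = A - S"
        using q permutes_image[OF q(1)] by (simp add: image_set_diff[OF inj])
      then have "bij_betw (\<lambda>x. if x \<in> S then x else q x) (A - S) (A - S)"
        using inj by (auto simp: bij_betw_def inj_on_def inj_def)
      then have "(\<lambda>x. if x \<in> S then x else q x) permutes (A - S)"
        using q(1) by (intro bij_imp_permutes) (auto simp: permutes_def)
      moreover have "bij_betw (\<lambda>x. if x \<in> S then q x else x) S S"
        using inj q(2) by (auto simp: bij_betw_def inj_on_def inj_def)
      then have "(\<lambda>x. if x \<in> S then q x else x) permutes S"
        by (intro bij_imp_permutes) auto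
      ultimately show "?f q \<in> {p. p permutes S} \<times> {p. p permutes (A - S)}"
        by simp
    qed
    show "finite ({p. p permutes S} \<times> {p. p permutes (A - S)})"
      using assms finite_subset by (auto intro!: finite_permutations)
  qed
  also have "\<dots> = fact (card S) * fact (card A - card S)"
    using assms finite_subset[OF assms(2,1)]
    by (simp add: card_cartesian_product card_permutations[OF refl] card_Diff_subset)
  finally show ?thesis .
qed

text \<open>Composition with \<open>inv p\<close> carries this set injectively into the stabilizer
  of \<open>S\<close>.\<close>

lemma card_permutes_same_image_le:
  assumes "finite A" "S \<subseteq> A" and p: "p permutes A"
  shows "card {q. q permutes A \<and> q ` S = p ` S} \<le> fact (card S) * fact (card A - card S)"
proof -
  have "card {q. q permutes A \<and> q ` S = p ` S} \<le> card {q. q permutes A \<and> q ` S = S}"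
  proof (rule card_inj_on_le[of "\<lambda>q. inv p \<circ> q"])
    show "inj_on (\<lambda>q. inv p \<circ> q) {q. q permutes A \<and> q ` S = p ` S}"
      using permutes_inj[OF permutes_inv[OF p]] by (auto simp: inj_on_def fun.inj_map_strong inj_def fun_eq_iff)
    show "(\<lambda>q. inv p \<circ> q) ` {q. q permutes A \<and> q ` S = p ` S} \<subseteq> {q. q permutes A \<and> q ` S = S}"
    proof (rule image_subsetI)
      fix q assume q: "q \<in> {q. q permutes A \<and> q ` S = p ` S}"
      have "(inv p \<circ> q) ` S = inv p ` (q ` S)"
        by (simp add: image_comp)
      also have "\<dots> = S"
        using q p by (simp add: image_comp permutes_inv_o)
      finally show "inv p \<circ> q \<in> {q. q permutes A \<and> q ` S = S}"
        using p q by (simp add: permutes_compose permutes_inv)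
    qed
    show "finite {q. q permutes A \<and> q ` S = S}"
      by (rule finite_subset[OF _ finite_permutations[OF assms(1)]]) auto
  qed
  also have "\<dots> \<le> fact (card S) * fact (card A - card S)"
    by (rule card_permutes_stabilizer_le) fact+
  finally show ?thesis .
qed

text \<open>In \<open>R\<close> the pair \<open>(s1, s2)\<close> is \<open>(p1, p2)\<close> with the
  two values exchanged off \<open>S\<close>, so it is determined by \<open>(p1, p2)\<close>. Since
  \<open>s1\<close> agrees with \<open>p1\<close> on \<open>S\<close> and with \<open>p2\<close> on
  \<open>A - S\<close>, bijectivity of \<open>s1\<close> makes \<open>p1\<close>
  S\<open>and\<close>p2 \<open>(A - S)\<close> complementary. Hence \<open>p2\<close> S = p1
  \<open>S\<close>, and it suffices to count pairs with equal images of \<open>S\<close>.\<close>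

lemma card_exchange_quadruples_le:
  assumes fin: "finite A" and S: "S \<subseteq> A"
  defines "P \<equiv> {p. p permutes A}"
  defines "R \<equiv> {((p1, p2), (s1, s2)) \<in> (P \<times> P) \<times> (P \<times> P).
    (\<forall>i\<in>S. p1 i = s1 i \<and> p2 i = s2 i) \<and> (\<forall>i\<in>A - S. p1 i = s2 i \<and> p2 i = s1 i)}"
  shows "card R \<le> fact (card A) * (fact (card S) * fact (card A - card S))"
proof -
  have finP: "finite P" using fin by (simp add: P_def finite_permutations)
  have "card R \<le> card (SIGMA p:P. {q \<in> P. q ` S = p ` S})"
  proof (rule card_inj_on_le[of fst])
    show "inj_on fst R"
    proof (rule inj_onI)
      fix a b assume ab: "a \<in> R" "b \<in> R" "fst a = fst b"
      obtain p1 p2 s1 s2 s1' s2' where a: "a = ((p1, p2), (s1, s2))" and b: "b = ((p1, p2), (s1', s2'))"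
        using ab(3) by (metis prod.collapse)
      have "s1 i = s1' i \<and> s2 i = s2' i" for i
      proof (cases "i \<in> A")
        case True
        then show ?thesis using ab(1,2) unfolding a b R_def by (cases "i \<in> S") auto
      next
        case False
        then show ?thesis using ab(1,2) unfolding a b R_def P_def by (auto simp: permutes_def)
      qed
      then show "a = b" unfolding a b by auto
    qed
    show "fst ` R \<subseteq> (SIGMA p:P. {q \<in> P. q ` S = p ` S})"
    proof (rule image_subsetI)
      fix z assume z: "z \<in> R"
      obtain p1 p2 s1 s2 where z_eq: "z = ((p1, p2), (s1, s2))"
        by (metis prod.collapse)
      have R: "((p1, p2), (s1, s2)) \<in> R"
        using z z_eq by simp
      have P: "p1 permutes A" "p2 permutes A" "s1 permutes A"
        using R by (auto simp: R_def P_def)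
      have "p2 ` A - p2 ` S = p2 ` (A - S)"
        using permutes_inj[OF P(2)] by (simp add: image_set_diff)
      also have "p2 ` (A - S) = s1 ` (A - S)"
        using R by (auto simp: R_def intro!: image_cong)
      also have "\<dots> = s1 ` A - s1 ` S"
        using permutes_inj[OF P(3)] by (simp add: image_set_diff)
      also have "s1 ` S = p1 ` S"
        using R by (auto simp: R_def intro!: image_cong)
      finally have "A - p2 ` S = A - p1 ` S"
        using P by (simp add: permutes_image)
      moreover have "p2 ` S \<subseteq> A" "p1 ` S \<subseteq> A"
        using P S permutes_in_image by fastforce+
      ultimately have "p2 ` S = p1 ` S" by blast
      with P show "fst z \<in> (SIGMA p:P. {q \<in> P. q ` S = p ` S})"
        by (simp add: P_def z_eq)
    qed
    show "finite (SIGMA p:P. {q \<in> P. q ` S = p ` S})"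
      using finP by auto
  qed
  also have "\<dots> = (\<Sum>p\<in>P. card {q \<in> P. q ` S = p ` S})"
    using finP by (simp add: card_SigmaI)
  also have "\<dots> \<le> (\<Sum>p\<in>P. fact (card S) * fact (card A - card S))"
    using card_permutes_same_image_le[OF fin S] by (intro sum_mono) (auto simp: P_def)
  also have "\<dots> = fact (card A) * (fact (card S) * fact (card A - card S))"
    using fin by (simp add: P_def card_permutations[OF refl])
  finally show ?thesis .
qed

text \<open>
  Expanding the product over the set \<open>S\<close> of rows where the first alternative is chosen, each \<open>S\<close>
  contributes at most \<open>n! |S|! (n - |S|)!\<close>, and \<open>(n choose |S|) |S|! (n - |S|)! = n!\<close>.
\<close>

lemma sum_permutations_matchings_le:
  assumes fin: "finite A"
  defines "Q \<equiv> {p. p permutes A} \<times> {p. p permutes A}"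
  shows "(\<Sum>a\<in>Q. \<Sum>b\<in>Q. \<Prod>i\<in>A.
      of_bool (fst a i = fst b i \<and> snd a i = snd b i) + of_bool (fst a i = snd b i \<and> snd a i = fst b i))
    \<le> (real (card A) + 1) * (fact (card A))\<^sup>2"
proof -
  let ?f = "\<lambda>a b i. of_bool (fst a i = fst b i \<and> snd a i = snd b i) :: real"
  let ?g = "\<lambda>a b i. of_bool (fst a i = snd b i \<and> snd a i = fst b i) :: real"
  let ?R = "\<lambda>S. {(a, b) \<in> Q \<times> Q. (\<forall>i\<in>S. fst a i = fst b i \<and> snd a i = snd b i) \<and>
                                (\<forall>i\<in>A - S. fst a i = snd b i \<and> snd a i = fst b i)}"
  have finQ: "finite Q" using fin by (simp add: Q_def finite_permutations)
  have prod_of_bool: "(\<Prod>i\<in>B. of_bool (h i)) = (of_bool (\<forall>i\<in>B. h i) :: real)" if "finite B" for h and B :: "'a set"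
    using that by induction auto
  have "(\<Sum>a\<in>Q. \<Sum>b\<in>Q. \<Prod>i\<in>A. ?f a b i + ?g a b i)
      = (\<Sum>a\<in>Q. \<Sum>b\<in>Q. \<Sum>S\<in>Pow A. (\<Prod>i\<in>S. ?f a b i) * (\<Prod>i\<in>A - S. ?g a b i))"
    using fin by (simp add: prod_add)
  also have "\<dots> = (\<Sum>S\<in>Pow A. \<Sum>a\<in>Q. \<Sum>b\<in>Q. (\<Prod>i\<in>S. ?f a b i) * (\<Prod>i\<in>A - S. ?g a b i))"
    by (simp add: sum.swap[of _ _ "Pow A"])
  also have "\<dots> = (\<Sum>S\<in>Pow A. real (card (?R S)))"
  proof (rule sum.cong[OF refl])
    fix S assume "S \<in> Pow A"
    then have "finite S" using fin finite_subset by auto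
    have "(\<Sum>a\<in>Q. \<Sum>b\<in>Q. (\<Prod>i\<in>S. ?f a b i) * (\<Prod>i\<in>A - S. ?g a b i))
        = (\<Sum>z\<in>Q \<times> Q. of_bool (z \<in> ?R S))"
      using \<open>finite S\<close> fin
      by (auto simp: sum.cartesian_product prod_of_bool case_prod_unfold mem_Times_iff simp flip: of_bool_conj intro!: sum.cong)
    also have "\<dots> = real (card (?R S))"
      using finQ by (simp add: sum_of_bool_eq) (auto intro!: arg_cong[where f = card])
    finally show "(\<Sum>a\<in>Q. \<Sum>b\<in>Q. (\<Prod>i\<in>S. ?f a b i) * (\<Prod>i\<in>A - S. ?g a b i)) = real (card (?R S))" .
  qed
  also have "\<dots> \<le> (\<Sum>S\<in>Pow A. fact (card A) * (fact (card S) * fact (card A - card S)))"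
  proof (rule sum_mono)
    fix S assume "S \<in> Pow A"
    then have "card (?R S) \<le> fact (card A) * (fact (card S) * fact (card A - card S))"
      using card_exchange_quadruples_le[OF fin, of S]
      by (simp add: Q_def case_prod_unfold mem_Times_iff conj_commute)
    then have "real (card (?R S)) \<le> real (fact (card A) * (fact (card S) * fact (card A - card S)))"
      by (simp only: of_nat_le_iff)
    then show "real (card (?R S)) \<le> fact (card A) * (fact (card S) * fact (card A - card S))"
      by simp
  qed
  also have "\<dots> = (\<Sum>j\<le>card A. \<Sum>S | S \<in> Pow A \<and> card S = j. fact (card A) * (fact (card S) * fact (card A - card S)))"
    using fin by (intro sum.group[symmetric]) (auto intro: card_mono)
  also have "\<dots> = (\<Sum>j\<le>card A. real (card A choose j) * (fact (card A) * (fact j * fact (card A - j))))"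
    using fin by (intro sum.cong) (auto simp: n_subsets)
  also have "\<dots> = (\<Sum>j\<le>card A. (fact (card A))\<^sup>2)"
    by (intro sum.cong) (auto simp: binomial_fact power2_eq_square)
  also have "\<dots> = (real (card A) + 1) * (fact (card A))\<^sup>2"
    by simp
  finally show ?thesis .
qed

subsection \<open>Gaussian moments\<close>

lemma sets_real_gaussian_half [measurable_cong]: "sets real_gaussian_half = sets borel"
  by (simp add: real_gaussian_half_def)

lemma prob_space_real_gaussian_half: "prob_space real_gaussian_half"
  unfolding real_gaussian_half_def by (rule prob_space_normal_density) simp

lemma measurable_Complex [measurable]:
  "(\<lambda>(a, b). Complex a b) \<in> real_gaussian_half \<Otimes>\<^sub>M real_gaussian_half \<rightarrow>\<^sub>M borel"
proof -
  have "(\<lambda>(a, b). Complex a b) = (\<lambda>(a, b). complex_of_real a + \<i> * complex_of_real b)"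
    by (auto simp: complex_eq_iff)
  then show ?thesis by simp
qed

lemma real_gaussian_half_moment_even:
  "has_bochner_integral real_gaussian_half (\<lambda>x. x ^ (2 * k)) (fact (2 * k) / (4 ^ k * fact k))"
  unfolding real_gaussian_half_def
  using normal_moment_even[of "sqrt (1 / 2)" 0 k]
  by (intro has_bochner_integral_density) auto

lemma real_gaussian_half_moment_odd:
  "has_bochner_integral real_gaussian_half (\<lambda>x. x ^ (2 * k + 1)) 0"
  unfolding real_gaussian_half_def
  using normal_moment_odd[of "sqrt (1 / 2)" 0 k]
  by (intro has_bochner_integral_density) auto

text \<open>The moments of the real Gaussian of variance 1/2: the usual
  \<open>(2 k)! / (2^k k!)\<close>, scaled by \<open>(1/2)^k\<close>, and 0 for odd exponents by
  symmetry.\<close>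

definition half_moment :: "nat \<Rightarrow> real" where
  "half_moment p = (if even p then fact p / (4 ^ (p div 2) * fact (p div 2)) else 0)"

lemma real_gaussian_half_moment:
  "has_bochner_integral real_gaussian_half (\<lambda>x. x ^ p) (half_moment p)"
proof (cases "even p")
  case True
  then obtain k where "p = 2 * k" by (elim evenE)
  then show ?thesis using real_gaussian_half_moment_even[of k] by (simp add: half_moment_def)
next
  case False
  then obtain k where "p = 2 * k + 1" by (elim oddE)
  then show ?thesis using real_gaussian_half_moment_odd[of k] by (simp add: half_moment_def)
qed

lemma (in pair_sigma_finite) has_bochner_integral_pair_mult:
  fixes f :: "'a \<Rightarrow> real" and g :: "'b \<Rightarrow> real"
  assumes f: "has_bochner_integral M1 f a" and g: "has_bochner_integral M2 g b"
  shows "has_bochner_integral (M1 \<Otimes>\<^sub>M M2) (\<lambda>(x, y). f x * g y) (a * b)"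
proof -
  note f' = f[unfolded has_bochner_integral_iff] and g' = g[unfolded has_bochner_integral_iff]
  have [measurable]: "f \<in> borel_measurable M1" "g \<in> borel_measurable M2"
    using f' g' by auto
  have int: "integrable (M1 \<Otimes>\<^sub>M M2) (\<lambda>(x, y). f x * g y)"
    using f' g' by (intro Fubini_integrable) (auto simp: abs_mult)
  have "(\<integral>z. (case z of (x, y) \<Rightarrow> f x * g y) \<partial>(M1 \<Otimes>\<^sub>M M2)) = (\<integral>x. \<integral>y. f x * g y \<partial>M2 \<partial>M1)"
    using integral_fst'[OF int] by simp
  also have "\<dots> = a * b"
    using f' g' by simp
  finally show ?thesis
    using int by (simp add: has_bochner_integral_iff)
qed

lemma std_complex_gaussian_moment_Re_Im:
  "has_bochner_integral std_complex_gaussian (\<lambda>z. complex_of_real (Re z ^ p * Im z ^ q))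
     (complex_of_real (half_moment p * half_moment q))"
proof -
  interpret G: prob_space real_gaussian_half by (rule prob_space_real_gaussian_half)
  interpret P: pair_prob_space real_gaussian_half real_gaussian_half ..
  have "has_bochner_integral (real_gaussian_half \<Otimes>\<^sub>M real_gaussian_half)
      (\<lambda>(x, y). x ^ p * y ^ q) (half_moment p * half_moment q)"
    by (intro P.has_bochner_integral_pair_mult real_gaussian_half_moment)
  then have "has_bochner_integral (real_gaussian_half \<Otimes>\<^sub>M real_gaussian_half)
      (\<lambda>z. complex_of_real (case z of (x, y) \<Rightarrow> x ^ p * y ^ q)) (complex_of_real (half_moment p * half_moment q))"
    by (rule has_bochner_integral_of_real)
  then show ?thesis
    unfolding std_complex_gaussian_def
    by (intro has_bochner_integral_distr) (auto simp: case_prod_unfold)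
qed

text \<open>Rotation invariance in coordinates: each monomial is expanded into products of powers of
  \<open>Re z\<close> and \<open>Im z\<close>, and the remaining cases follow by conjugation.
  Exponents up to 2 suffice for fourth moments of permanents: a product of two permutation monomials
  contains each entry at most twice.\<close>

lemma std_complex_gaussian_moment:
  assumes "a \<le> 2" "b \<le> 2"
  shows "has_bochner_integral std_complex_gaussian (\<lambda>z. z ^ a * cnj z ^ b) (if a = b then fact a else 0)"
proof -
  note R = std_complex_gaussian_moment_Re_Im
  have [simp]: "half_moment 0 = 1" "half_moment (Suc 0) = 0" "half_moment 2 = 1 / 2" "half_moment 3 = 0" "half_moment 4 = 3 / 4"
    by (auto simp: half_moment_def fact_numeral)
  have I: "has_bochner_integral std_complex_gaussian f y"
    if "has_bochner_integral std_complex_gaussian g x" "\<And>z. f z = g z" "y = x" for f g :: "complex \<Rightarrow> complex" and x y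
    using that by (metis (no_types, lifting) ext)
  note add = has_bochner_integral_add and mult = has_bochner_integral_mult_right
  have m1: "has_bochner_integral std_complex_gaussian (\<lambda>z. z) 0"
    by (rule I[OF add[OF R[of 1 0] mult[OF R[of 0 1], of \<i>]]]) (auto simp: complex_eq_iff)
  have m2: "has_bochner_integral std_complex_gaussian (\<lambda>z. z\<^sup>2) 0"
    by (rule I[OF add[OF add[OF R[of 2 0] mult[OF R[of 0 2], of "-1"]] mult[OF R[of 1 1], of "2 * \<i>"]]])
       (auto simp: complex_eq_iff power2_eq_square)
  have m11: "has_bochner_integral std_complex_gaussian (\<lambda>z. z * cnj z) 1"
    by (rule I[OF add[OF R[of 2 0] R[of 0 2]]]) (auto simp: complex_eq_iff power2_eq_square)
  have m21: "has_bochner_integral std_complex_gaussian (\<lambda>z. z\<^sup>2 * cnj z) 0"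
    by (rule I[OF add[OF add[OF R[of 3 0] R[of 1 2]] mult[OF add[OF R[of 2 1] R[of 0 3]], of \<i>]]])
       (auto simp: complex_eq_iff power2_eq_square power3_eq_cube algebra_simps)
  \<comment> \<open>With \<open>z = x + i y\<close> the integrand is
    \<open>x^4 + y^4 + 2 x^2 y^2\<close>, of mean \<open>3/4 + 3/4 + 2 * 1/4 = 2\<close>.\<close>
  have m22: "has_bochner_integral std_complex_gaussian (\<lambda>z. z\<^sup>2 * (cnj z)\<^sup>2) 2"
    by (rule I[OF add[OF add[OF R[of 4 0] R[of 0 4]] mult[OF R[of 2 2], of 2]]])
       (auto simp: complex_eq_iff power2_eq_square power4_eq_xxxx algebra_simps)
  interpret prob_space std_complex_gaussian by (rule prob_space_std_complex_gaussian)
  have m0: "has_bochner_integral std_complex_gaussian (\<lambda>z. 1 :: complex) 1"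
    by (simp add: has_bochner_integral_iff prob_space)
  note cnj = has_bochner_integral_bounded_linear[OF bounded_linear_cnj]
  have m': "has_bochner_integral std_complex_gaussian (\<lambda>z. cnj z) 0"
    "has_bochner_integral std_complex_gaussian (\<lambda>z. (cnj z)\<^sup>2) 0"
    "has_bochner_integral std_complex_gaussian (\<lambda>z. z * (cnj z)\<^sup>2) 0"
    using cnj[OF m1] cnj[OF m2] cnj[OF m21] by (simp_all add: mult.commute)
  have "a = 0 \<or> a = 1 \<or> a = 2" "b = 0 \<or> b = 1 \<or> b = 2"
    using assms by auto
  then show ?thesis
    using m0 m1 m2 m11 m21 m22 m' by (elim disjE) simp_all
qed

text \<open>The density is \<open>exp (- x^2) / sqrt pi\<close>, so the weight turns it into an
  unnormalized standard normal; the value is the ratio of the normalizing constants.\<close>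

lemma real_gaussian_half_exp_square:
  "(\<integral>\<^sup>+ x. ennreal (exp (x\<^sup>2 / 2)) \<partial>real_gaussian_half) = ennreal (sqrt 2)"
proof -
  have eq: "normal_density 0 (sqrt (1 / 2)) x * exp (x\<^sup>2 / 2) = sqrt 2 * std_normal_density x" for x
  proof -
    have "exp (- x\<^sup>2) * exp (x\<^sup>2 / 2) = exp (- x\<^sup>2 / 2)"
      by (simp flip: exp_add)
    then show ?thesis
      by (simp add: normal_density_def real_sqrt_mult real_sqrt_divide power_divide)
  qed
  have "(\<integral>\<^sup>+ x. ennreal (exp (x\<^sup>2 / 2)) \<partial>real_gaussian_half)
      = (\<integral>\<^sup>+ x. ennreal (normal_density 0 (sqrt (1 / 2)) x) * ennreal (exp (x\<^sup>2 / 2)) \<partial>lborel)"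
    unfolding real_gaussian_half_def by (intro nn_integral_density) auto
  also have "\<dots> = (\<integral>\<^sup>+ x. ennreal (sqrt 2) * ennreal (std_normal_density x) \<partial>lborel)"
    by (simp add: eq flip: ennreal_mult')
  also have "\<dots> = ennreal (sqrt 2) * (\<integral>\<^sup>+ x. ennreal (std_normal_density x) \<partial>lborel)"
    by (intro nn_integral_cmult) auto
  also have "(\<integral>\<^sup>+ x. ennreal (std_normal_density x) \<partial>lborel) = 1"
    using prob_space.emeasure_space_1[OF prob_space_normal_density[of 1 0]]
    by (simp add: emeasure_density)
  finally show ?thesis by simp
qed

text \<open>\<open>|z|^2\<close> splits into two independent squares, giving
  \<open>sqrt 2 * sqrt 2\<close>. This factor per entry is the origin of \<open>2 ^ k\<close> in the
  row tail.\<close>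

lemma std_complex_gaussian_exp_square:
  "(\<integral>\<^sup>+ z. ennreal (exp ((cmod z)\<^sup>2 / 2)) \<partial>std_complex_gaussian) = 2"
proof -
  interpret G: prob_space real_gaussian_half by (rule prob_space_real_gaussian_half)
  have "(\<integral>\<^sup>+ z. ennreal (exp ((cmod z)\<^sup>2 / 2)) \<partial>std_complex_gaussian)
      = (\<integral>\<^sup>+ z. ennreal (exp ((cmod (case z of (a, b) \<Rightarrow> Complex a b))\<^sup>2 / 2)) \<partial>(real_gaussian_half \<Otimes>\<^sub>M real_gaussian_half))"
    unfolding std_complex_gaussian_def by (intro nn_integral_distr) auto
  also have "\<dots> = (\<integral>\<^sup>+ z. ennreal (exp ((fst z)\<^sup>2 / 2)) * ennreal (exp ((snd z)\<^sup>2 / 2)) \<partial>(real_gaussian_half \<Otimes>\<^sub>M real_gaussian_half))"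
    by (intro nn_integral_cong) (auto simp: cmod_power2 add_divide_distrib exp_add ennreal_mult')
  also have "\<dots> = (\<integral>\<^sup>+ x. \<integral>\<^sup>+ y. ennreal (exp (x\<^sup>2 / 2)) * ennreal (exp (y\<^sup>2 / 2)) \<partial>real_gaussian_half \<partial>real_gaussian_half)"
    by (subst G.nn_integral_fst[symmetric]) auto
  also have "\<dots> = ennreal (sqrt 2) * ennreal (sqrt 2)"
    by (simp add: nn_integral_cmult nn_integral_multc real_gaussian_half_exp_square)
  also have "\<dots> = 2"
    by (simp flip: ennreal_mult')
  finally show ?thesis .
qed

text \<open>The density never vanishes, so an interval that is null for the Gaussian would be null
  for Lebesgue measure. The square of half-side \<open>r / 2\<close> lies in the disc because
  \<open>|z| \<le> |Re z| + |Im z|\<close>. Mere positivity is enough: it is used for one fixed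
  radius at a time.\<close>

lemma std_complex_gaussian_cball_pos:
  assumes "r > 0"
  shows "measure std_complex_gaussian (cball 0 r) > 0"
proof -
  interpret G: prob_space real_gaussian_half by (rule prob_space_real_gaussian_half)
  interpret C: prob_space std_complex_gaussian by (rule prob_space_std_complex_gaussian)
  let ?I = "{- r / 2..r / 2}"
  have "?I \<notin> null_sets real_gaussian_half"
  proof
    assume "?I \<in> null_sets real_gaussian_half"
    then have "AE x in lborel. x \<in> ?I \<longrightarrow> ennreal (normal_density 0 (sqrt (1 / 2)) x) = 0"
      unfolding real_gaussian_half_def by (subst (asm) null_sets_density_iff) auto
    moreover have "ennreal (normal_density 0 (sqrt (1 / 2)) x) \<noteq> 0" for x
      using normal_density_pos[of "sqrt (1 / 2)" 0 x] by simp
    ultimately have "AE x in lborel. x \<notin> ?I"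
      by simp
    then have "?I \<in> null_sets lborel"
      by (subst (asm) AE_iff_null_sets[symmetric]) auto
    then show False
      using assms by (auto simp: null_sets_def)
  qed
  then have pos: "emeasure real_gaussian_half ?I > 0"
    by (auto simp: null_sets_def zero_less_iff_neq_zero)
  have "0 < emeasure real_gaussian_half ?I * emeasure real_gaussian_half ?I"
    using pos by (simp add: ennreal_zero_less_mult_iff)
  also have "\<dots> = emeasure (real_gaussian_half \<Otimes>\<^sub>M real_gaussian_half) (?I \<times> ?I)"
    by (rule G.emeasure_pair_measure_Times[symmetric]) auto
  also have "\<dots> \<le> emeasure (real_gaussian_half \<Otimes>\<^sub>M real_gaussian_half)
      ((\<lambda>(a, b). Complex a b) -` cball 0 r \<inter> space (real_gaussian_half \<Otimes>\<^sub>M real_gaussian_half))"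
  proof (rule emeasure_mono)
    have "cmod (Complex a b) \<le> r" if "a \<in> ?I" "b \<in> ?I" for a b
      using that cmod_le[of "Complex a b"] by auto
    then show "?I \<times> ?I \<subseteq> (\<lambda>(a, b). Complex a b) -` cball 0 r \<inter> space (real_gaussian_half \<Otimes>\<^sub>M real_gaussian_half)"
      by (auto simp: space_pair_measure real_gaussian_half_def)
    show "(\<lambda>(a, b). Complex a b) -` cball 0 r \<inter> space (real_gaussian_half \<Otimes>\<^sub>M real_gaussian_half)
        \<in> sets (real_gaussian_half \<Otimes>\<^sub>M real_gaussian_half)"
      by (rule measurable_sets[OF measurable_Complex]) auto
  qed
  also have "\<dots> = emeasure std_complex_gaussian (cball 0 r)"
    unfolding std_complex_gaussian_def by (subst emeasure_distr) auto
  finally show ?thesis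
    by (simp add: C.emeasure_eq_measure)
qed

subsection \<open>Tail bounds for Gaussian matrices\<close>

lemma product_prob_space_std_complex_gaussian: "product_prob_space (\<lambda>_ :: nat \<times> nat. std_complex_gaussian)"
proof -
  interpret prob_space std_complex_gaussian by (rule prob_space_std_complex_gaussian)
  show ?thesis by unfold_locales
qed

lemma measurable_permanent [measurable]: "permanent k \<in> borel_measurable (gaussian_ensemble k)"
  unfolding permanent_def
proof (intro borel_measurable_sum borel_measurable_prod measurable_entry)
  fix \<pi> i assume "\<pi> \<in> {\<pi>. \<pi> permutes {1..k}}" and i: "i \<in> {1..k}"
  then have "\<pi> permutes {1..k}" by simp
  then show "\<pi> i \<in> {1..k}"
    by (rule iffD2[OF permutes_in_image i])
qed

section \<open>Fourth moment and tail of the permanent\<close>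

text \<open>The multiplicity of column \<open>j\<close> in the multiset of \<open>p\<close> and
  \<open>q\<close>, that is, the exponent of the entry in column \<open>j\<close> when a row
  contributes its entries in columns \<open>p\<close> and \<open>q\<close>.\<close>

definition pair_count :: "'a \<Rightarrow> 'a \<Rightarrow> 'a \<Rightarrow> nat" where
  "pair_count p q j = of_bool (p = j) + of_bool (q = j)"

lemma prod_pair_count:
  fixes x :: "'a \<Rightarrow> 'b :: comm_monoid_mult"
  assumes "finite J" "p \<in> J" "q \<in> J"
  shows "(\<Prod>j\<in>J. x j ^ pair_count p q j) = x p * x q"
proof -
  have "x j ^ pair_count p q j = (if p = j then x j else 1) * (if q = j then x j else 1)" for j
    by (simp add: pair_count_def)
  then show ?thesis
    using assms by (simp add: prod.distrib)
qed

text \<open>The moments of a row survive only if the multisets of \<open>p, q\<close> and of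
  \<open>r, s\<close> coincide, which happens through the straight or the swapped matching. For
  \<open>p = q\<close> both matchings hold, and their sum 2 is the factorial of the double
  exponent.\<close>

lemma prod_fact_pair_count:
  fixes p q r s :: 'a
  assumes J: "finite J" "p \<in> J" "q \<in> J"
  shows "(\<Prod>j\<in>J. if pair_count p q j = pair_count r s j then fact (pair_count p q j) else 0)
    = (of_bool (p = r \<and> q = s) + of_bool (p = s \<and> q = r) :: complex)"
proof (cases "(p = r \<and> q = s) \<or> (p = s \<and> q = r)")
  case True
  then have eq: "pair_count p q j = pair_count r s j" for j
    by (auto simp: pair_count_def)
  have fact: "fact (pair_count p q j) = (if j = p then if p = q then 2 else 1 else (1::complex))" for j
    by (auto simp: pair_count_def)
  have "(\<Prod>j\<in>J. if pair_count p q j = pair_count r s j then fact (pair_count p q j) else 0)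
      = (\<Prod>j\<in>J. if j = p then if p = q then 2 else 1 else 1 :: complex)"
    by (rule prod.cong[OF refl]) (rule trans[OF if_P[OF eq] fact])
  also have "\<dots> = (if p = q then 2 else 1)"
    using J by simp
  also have "\<dots> = of_bool (p = r \<and> q = s) + of_bool (p = s \<and> q = r)"
    using True by auto
  finally show ?thesis .
next
  case False
  \<comment> \<open>If neither matching holds, the multiplicities already differ at \<open>p\<close>
    or at \<open>q\<close>, and that column annihilates the product.\<close>
  have "pair_count p q p \<noteq> pair_count r s p \<or> pair_count p q q \<noteq> pair_count r s q"
  proof (cases "p = q")
    case True
    then show ?thesis
      using False by (cases "p = r"; cases "p = s") (simp_all add: pair_count_def)
  next
    case pq: False
    then show ?thesis
      using False by (cases "p = r"; cases "p = s"; cases "q = r"; cases "q = s") (simp_all add: pair_count_def)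
  qed
  then obtain j where j: "j \<in> J" "pair_count p q j \<noteq> pair_count r s j"
    using J by blast
  have "(\<Prod>j\<in>J. if pair_count p q j = pair_count r s j then fact (pair_count p q j) else 0) = (0 :: complex)"
    using j(1) by (intro prod_zero[OF J(1)] bexI[of _ j] if_not_P[OF j(2)])
  also have "(0 :: complex) = of_bool (p = r \<and> q = s) + of_bool (p = s \<and> q = r)"
    using False by (simp only: de_Morgan_disj simp_thms of_bool_eq add_0)
  finally show ?thesis .
qed

text \<open>Wick's formula, applied in each row.\<close>

lemma permutation_monomials_moment:
  assumes "p permutes {1..k}" "q permutes {1..k}" "r permutes {1..k}" "s permutes {1..k}"
  shows "has_bochner_integral (gaussian_ensemble k)
    (\<lambda>X. (\<Prod>i=1..k. X (i, p i) * X (i, q i)) * cnj (\<Prod>i=1..k. X (i, r i) * X (i, s i)))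
    (\<Prod>i=1..k. of_bool (p i = r i \<and> q i = s i) + of_bool (p i = s i \<and> q i = r i))"
proof -
  interpret product_prob_space "\<lambda>_ :: nat \<times> nat. std_complex_gaussian" "{1..k} \<times> {1..k}"
    by (rule product_prob_space_std_complex_gaussian)
  \<comment> \<open>The monomials are spread over all \<open>k * k\<close> entries, with exponent 0
    where an entry does not occur, so that independence factors the integral into moments of single
    entries.\<close>
  define h :: "nat \<times> nat \<Rightarrow> complex \<Rightarrow> complex" where
    "h = (\<lambda>(i, j) z. z ^ pair_count (p i) (q i) j * cnj z ^ pair_count (r i) (s i) j)"
  define v :: "nat \<times> nat \<Rightarrow> complex" where
    "v = (\<lambda>(i, j). if pair_count (p i) (q i) j = pair_count (r i) (s i) j
                   then fact (pair_count (p i) (q i) j) else 0)"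
  have le: "pair_count a b j \<le> 2" for a b j :: nat
    by (simp add: pair_count_def)
  have h: "has_bochner_integral std_complex_gaussian (h ij) (v ij)" for ij
    using std_complex_gaussian_moment[OF le le] by (auto simp: h_def v_def split: prod.split)
  then have int_h: "integrable std_complex_gaussian (h ij)" and h_eq: "integral\<^sup>L std_complex_gaussian (h ij) = v ij" for ij
    by (auto simp: has_bochner_integral_iff)
  have "has_bochner_integral (gaussian_ensemble k) (\<lambda>X. \<Prod>ij\<in>{1..k} \<times> {1..k}. h ij (X ij)) (\<Prod>ij\<in>{1..k} \<times> {1..k}. v ij)"
    unfolding gaussian_ensemble_def has_bochner_integral_iff
    using product_integrable_prod[of "{1..k} \<times> {1..k}" h] product_integral_prod[of "{1..k} \<times> {1..k}" h] int_h h_eq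
    by simp
  moreover have "(\<Prod>ij\<in>{1..k} \<times> {1..k}. h ij (X ij))
      = (\<Prod>i=1..k. X (i, p i) * X (i, q i)) * cnj (\<Prod>i=1..k. X (i, r i) * X (i, s i))" for X
  proof -
    have "(\<Prod>ij\<in>{1..k} \<times> {1..k}. h ij (X ij)) = (\<Prod>i=1..k. \<Prod>j=1..k. h (i, j) (X (i, j)))"
      by (simp add: prod.cartesian_product)
    also have "\<dots> = (\<Prod>i=1..k. (X (i, p i) * X (i, q i)) * cnj (X (i, r i) * X (i, s i)))"
    proof (rule prod.cong[OF refl])
      fix i assume "i \<in> {1..k}"
      then have "p i \<in> {1..k}" "q i \<in> {1..k}" "r i \<in> {1..k}" "s i \<in> {1..k}"
        using assms permutes_in_image by metis+
      then show "(\<Prod>j=1..k. h (i, j) (X (i, j))) = (X (i, p i) * X (i, q i)) * cnj (X (i, r i) * X (i, s i))"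
        using prod_pair_count[of "{1..k}" "p i" "q i" "\<lambda>j. X (i, j)"]
          prod_pair_count[of "{1..k}" "r i" "s i" "\<lambda>j. cnj (X (i, j))"]
        by (simp add: h_def prod.distrib)
    qed
    also have "\<dots> = (\<Prod>i=1..k. X (i, p i) * X (i, q i)) * cnj (\<Prod>i=1..k. X (i, r i) * X (i, s i))"
      by (simp add: prod.distrib)
    finally show ?thesis .
  qed
  moreover have "(\<Prod>ij\<in>{1..k} \<times> {1..k}. v ij)
      = (\<Prod>i=1..k. of_bool (p i = r i \<and> q i = s i) + of_bool (p i = s i \<and> q i = r i))"
  proof -
    have "(\<Prod>ij\<in>{1..k} \<times> {1..k}. v ij) = (\<Prod>i=1..k. \<Prod>j=1..k. v (i, j))"
      by (simp add: prod.cartesian_product)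
    also have "\<dots> = (\<Prod>i=1..k. of_bool (p i = r i \<and> q i = s i) + of_bool (p i = s i \<and> q i = r i))"
    proof (rule prod.cong[OF refl])
      fix i assume "i \<in> {1..k}"
      then have "p i \<in> {1..k}" "q i \<in> {1..k}"
        using assms permutes_in_image by metis+
      then show "(\<Prod>j=1..k. v (i, j)) = of_bool (p i = r i \<and> q i = s i) + of_bool (p i = s i \<and> q i = r i)"
        unfolding v_def by (simp only: prod.case) (rule prod_fact_pair_count, auto)
    qed
    finally show ?thesis .
  qed
  ultimately show ?thesis by simp
qed

lemma of_real_of_bool: "of_real (of_bool P) = of_bool P"
  by (cases P) auto

text \<open>\<open>|Per|^4\<close> is \<open>Per^2\<close> times its conjugate, and
  \<open>Per^2\<close> is a sum over pairs of permutations. Integrating term by term leaves, for two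
  such pairs, the number of ways to match them row by row, which is what the matching count
  bounds.\<close>

lemma permanent_fourth_moment:
  shows integrable_permanent_fourth: "integrable (gaussian_ensemble k) (\<lambda>X. cmod (permanent k X) ^ 4)"
    and permanent_fourth_moment_le:
      "(\<integral>X. cmod (permanent k X) ^ 4 \<partial>gaussian_ensemble k) \<le> (real k + 1) * (fact k)\<^sup>2"
proof -
  let ?P = "{p. p permutes {1..k}}"
  let ?Q = "?P \<times> ?P"
  let ?F = "\<lambda>a X. \<Prod>i=1..k. X (i, fst a i) * X (i, snd a i) :: complex"
  let ?w = "\<lambda>a b. \<Prod>i=1..k. of_bool (fst a i = fst b i \<and> snd a i = snd b i) + of_bool (fst a i = snd b i \<and> snd a i = fst b i)"
  have sq: "(permanent k X)\<^sup>2 = (\<Sum>a\<in>?Q. ?F a X)" for X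
    unfolding permanent_def power2_eq_square
    by (simp add: sum_product sum.cartesian_product prod.distrib case_prod_unfold)
  have four: "complex_of_real (cmod (permanent k X) ^ 4) = (\<Sum>a\<in>?Q. \<Sum>b\<in>?Q. ?F a X * cnj (?F b X))" for X
  proof -
    have "cmod (permanent k X) ^ 4 = (cmod ((permanent k X)\<^sup>2))\<^sup>2"
      using power_mult[of "cmod (permanent k X)" 2 2] by (simp add: norm_power)
    then have "complex_of_real (cmod (permanent k X) ^ 4) = (permanent k X)\<^sup>2 * cnj ((permanent k X)\<^sup>2)"
      by (simp only: complex_norm_square)
    also have "\<dots> = (\<Sum>a\<in>?Q. \<Sum>b\<in>?Q. ?F a X * cnj (?F b X))"
      unfolding sq cnj_sum sum_product ..
    finally show ?thesis .
  qed
  have "has_bochner_integral (gaussian_ensemble k) (\<lambda>X. \<Sum>a\<in>?Q. \<Sum>b\<in>?Q. ?F a X * cnj (?F b X)) (\<Sum>a\<in>?Q. \<Sum>b\<in>?Q. ?w a b)"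
    by (intro has_bochner_integral_sum permutation_monomials_moment) auto
  then have "has_bochner_integral (gaussian_ensemble k) (\<lambda>X. Re (complex_of_real (cmod (permanent k X) ^ 4)))
      (Re (\<Sum>a\<in>?Q. \<Sum>b\<in>?Q. ?w a b))"
    unfolding four by (rule has_bochner_integral_bounded_linear[OF bounded_linear_Re])
  \<comment> \<open>The moments were computed over the complex numbers; the weights are built from
    truth values, so taking real parts loses nothing.\<close>
  moreover have "(\<Sum>a\<in>?Q. \<Sum>b\<in>?Q. ?w a b) = complex_of_real (\<Sum>a\<in>?Q. \<Sum>b\<in>?Q. ?w a b)"
    by (simp add: of_real_of_bool)
  ultimately have I: "has_bochner_integral (gaussian_ensemble k) (\<lambda>X. cmod (permanent k X) ^ 4) (\<Sum>a\<in>?Q. \<Sum>b\<in>?Q. ?w a b)"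
    by (simp only: Re_complex_of_real)
  then show "integrable (gaussian_ensemble k) (\<lambda>X. cmod (permanent k X) ^ 4)"
    by (simp add: has_bochner_integral_iff)
  show "(\<integral>X. cmod (permanent k X) ^ 4 \<partial>gaussian_ensemble k) \<le> (real k + 1) * (fact k)\<^sup>2"
    using I sum_permutations_matchings_le[of "{1..k}"] by (simp add: has_bochner_integral_iff)
qed

text \<open>Markov's inequality for the fourth power. The factorials cancel, so the price for the
  decay \<open>t^-4\<close> is only the factor \<open>k + 1\<close>.\<close>

lemma permanent_tail_bound:
  assumes "t > 0"
  shows "measure (gaussian_ensemble k) {X \<in> space (gaussian_ensemble k). (cmod (permanent k X))\<^sup>2 > t\<^sup>2 * fact k}
    \<le> (real k + 1) / t ^ 4"
proof -
  interpret prob_space "gaussian_ensemble k" by (rule prob_space_gaussian_ensemble)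
  let ?M = "gaussian_ensemble k"
  have "measure ?M {X \<in> space ?M. (cmod (permanent k X))\<^sup>2 > t\<^sup>2 * fact k}
      \<le> measure ?M {X \<in> space ?M. cmod (permanent k X) ^ 4 \<ge> t ^ 4 * (fact k)\<^sup>2}"
  proof (rule finite_measure_mono)
    show "{X \<in> space ?M. (cmod (permanent k X))\<^sup>2 > t\<^sup>2 * fact k} \<subseteq> {X \<in> space ?M. cmod (permanent k X) ^ 4 \<ge> t ^ 4 * (fact k)\<^sup>2}"
    proof clarify
      fix X assume "t\<^sup>2 * fact k < (cmod (permanent k X))\<^sup>2"
      then have "(t\<^sup>2 * fact k)\<^sup>2 \<le> ((cmod (permanent k X))\<^sup>2)\<^sup>2"
        by (intro power_mono) auto
      then show "t ^ 4 * (fact k)\<^sup>2 \<le> cmod (permanent k X) ^ 4"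
        by (simp add: power_mult_distrib flip: power_mult)
    qed
  qed measurable
  also have "\<dots> \<le> (\<integral>X. cmod (permanent k X) ^ 4 \<partial>?M) / (t ^ 4 * (fact k)\<^sup>2)"
    using assms by (intro integral_Markov_inequality_measure[of _ _ "{}"] integrable_permanent_fourth) auto
  also have "\<dots> \<le> (real k + 1) * (fact k)\<^sup>2 / (t ^ 4 * (fact k)\<^sup>2)"
    by (intro divide_right_mono permanent_fourth_moment_le) auto
  also have "\<dots> = (real k + 1) / t ^ 4"
    by simp
  finally show ?thesis .
qed

section \<open>Tail of the norm of the first row\<close>

lemma measurable_first_row [measurable]:
  "(\<lambda>X. \<Sum>i=1..k. (cmod (X (1, i)))\<^sup>2) \<in> borel_measurable (gaussian_ensemble k)"
proof (rule borel_measurable_sum)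
  fix i assume "i \<in> {1..k}"
  then have [measurable]: "(\<lambda>X. X (1, i)) \<in> borel_measurable (gaussian_ensemble k)"
    by (intro measurable_entry) auto
  show "(\<lambda>X. (cmod (X (1, i)))\<^sup>2) \<in> borel_measurable (gaussian_ensemble k)"
    by measurable
qed

lemma first_row_exp_square:
  assumes "k \<ge> 1"
  shows "(\<integral>\<^sup>+ X. ennreal (exp ((\<Sum>i=1..k. (cmod (X (1, i)))\<^sup>2) / 2)) \<partial>gaussian_ensemble k) = 2 ^ k"
proof -
  interpret product_prob_space "\<lambda>_ :: nat \<times> nat. std_complex_gaussian" "{1..k} \<times> {1..k}"
    by (rule product_prob_space_std_complex_gaussian)
  \<comment> \<open>The exponential of the row sum as a product over all entries: those outside the
    first row contribute the factor 1.\<close>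
  define h :: "nat \<times> nat \<Rightarrow> complex \<Rightarrow> ennreal" where
    "h = (\<lambda>(i, j) z. if i = 1 then ennreal (exp ((cmod z)\<^sup>2 / 2)) else 1)"
  have h: "h ij \<in> borel_measurable std_complex_gaussian" for ij
    by (auto simp: h_def split: prod.split)
  have int_h: "integral\<^sup>N std_complex_gaussian (h (i, j)) = (if i = 1 then 2 else 1)" for i j
    by (simp add: h_def std_complex_gaussian_exp_square M.emeasure_space_1)
  have "ennreal (exp ((\<Sum>i=1..k. (cmod (X (1, i)))\<^sup>2) / 2)) = (\<Prod>ij\<in>{1..k} \<times> {1..k}. h ij (X ij))" for X
  proof -
    have "(\<Prod>ij\<in>{1..k} \<times> {1..k}. h ij (X ij)) = (\<Prod>i=1..k. \<Prod>j=1..k. h (i, j) (X (i, j)))"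
      by (simp add: prod.cartesian_product)
    also have "\<dots> = (\<Prod>i=1..k. if i = 1 then \<Prod>j=1..k. ennreal (exp ((cmod (X (1, j)))\<^sup>2 / 2)) else 1)"
      by (intro prod.cong) (auto simp: h_def)
    also have "\<dots> = (\<Prod>j=1..k. ennreal (exp ((cmod (X (1, j)))\<^sup>2 / 2)))"
      using assms by simp
    also have "\<dots> = ennreal (exp ((\<Sum>i=1..k. (cmod (X (1, i)))\<^sup>2) / 2))"
      by (simp add: prod_ennreal sum_divide_distrib exp_sum)
    finally show ?thesis by simp
  qed
  then have "(\<integral>\<^sup>+ X. ennreal (exp ((\<Sum>i=1..k. (cmod (X (1, i)))\<^sup>2) / 2)) \<partial>gaussian_ensemble k)
      = (\<Prod>ij\<in>{1..k} \<times> {1..k}. integral\<^sup>N std_complex_gaussian (h ij))"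
    unfolding gaussian_ensemble_def using h by (simp add: product_nn_integral_prod)
  also have "\<dots> = (\<Prod>i=1..k. \<Prod>j=1..k. if i = 1 then 2 else 1)"
    unfolding prod.cartesian_product by (intro prod.cong) (auto simp: int_h)
  also have "\<dots> = (\<Prod>i=1..k. if i = 1 then 2 ^ k else 1)"
    by (intro prod.cong) auto
  also have "\<dots> = 2 ^ k"
    using assms by simp
  finally show ?thesis .
qed

text \<open>Chernoff's bound with parameter 1/2. The exponential moment of \<open>|z|^2\<close> is
  finite only for parameters below 1.\<close>

lemma first_row_tail_bound:
  assumes "k \<ge> 1"
  shows "measure (gaussian_ensemble k) {X \<in> space (gaussian_ensemble k). (\<Sum>i=1..k. (cmod (X (1, i)))\<^sup>2) > t}
    \<le> 2 ^ k * exp (- t / 2)"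
proof -
  interpret prob_space "gaussian_ensemble k" by (rule prob_space_gaussian_ensemble)
  let ?M = "gaussian_ensemble k"
  let ?f = "\<lambda>X :: cmatrix. \<Sum>i=1..k. (cmod (X (1, i)))\<^sup>2"
  have "emeasure ?M {X \<in> space ?M. ?f X > t} \<le> emeasure ?M {X \<in> space ?M. 1 \<le> ennreal (exp (- t / 2)) * ennreal (exp (?f X / 2))}"
  proof (rule emeasure_mono)
    show "{X \<in> space ?M. ?f X > t} \<subseteq> {X \<in> space ?M. 1 \<le> ennreal (exp (- t / 2)) * ennreal (exp (?f X / 2))}"
      by (auto simp flip: ennreal_mult' exp_add)
    show "{X \<in> space ?M. 1 \<le> ennreal (exp (- t / 2)) * ennreal (exp (?f X / 2))} \<in> sets ?M"
      by measurable
  qed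
  also have "\<dots> \<le> ennreal (exp (- t / 2)) * (\<integral>\<^sup>+ X. ennreal (exp (?f X / 2)) * indicator (space ?M) X \<partial>?M)"
  proof (rule nn_integral_Markov_inequality)
    show "(\<lambda>X. ennreal (exp (?f X / 2)) * indicator (space ?M) X) \<in> borel_measurable ?M"
      by measurable
  qed simp
  also have "(\<integral>\<^sup>+ X. ennreal (exp (?f X / 2)) * indicator (space ?M) X \<partial>?M) = (\<integral>\<^sup>+ X. ennreal (exp (?f X / 2)) \<partial>?M)"
    by (intro nn_integral_cong) auto
  also have "\<dots> = ennreal (2 ^ k)"
    unfolding first_row_exp_square[OF assms] by (simp flip: ennreal_power)
  also have "ennreal (exp (- t / 2)) * ennreal (2 ^ k) = ennreal (2 ^ k * exp (- t / 2))"
    by (simp add: mult.commute flip: ennreal_mult')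
  finally show ?thesis
    by (simp add: emeasure_eq_measure)
qed

subsection \<open>Acceptance probabilities\<close>

lemma cmod_le_of_square_le:
  assumes "(cmod z)\<^sup>2 \<le> \<delta>\<^sup>2 * fact k" "0 \<le> \<delta>"
  shows "cmod z \<le> \<delta> * sqrt (fact k)"
proof (rule power2_le_imp_le)
  show "(cmod z)\<^sup>2 \<le> (\<delta> * sqrt (fact k))\<^sup>2"
    using assms(1) by (simp add: power_mult_distrib)
  show "0 \<le> \<delta> * sqrt (fact k)"
    using assms(2) by simp
qed

lemma permanent_1: "permanent 1 X = X (1, 1)"
  by (simp add: permanent_def)

lemma minor_in_cmatrices: "minor k X i \<in> cmatrices (k - 1)"
  unfolding minor_def cmatrices_def by (simp add: restrict_PiE_iff)

text \<open>Of the allowance \<open>n \<delta> sqrt (k!)\<close>, one share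
  \<open>\<delta> sqrt (k!)\<close> covers the error of \<open>\<O> k\<close> itself and leaves
  \<open>n - 1\<close> shares for the errors on the minors; hence the bound on the row. For
  \<open>k = 1\<close> the test compares with the entry directly. Exempting that case matters at
  \<open>n = 1\<close>, where the bound on the row would be 0.\<close>

lemma LinearityTest_accept:
  assumes near: "\<forall>k\<in>{1..n}. \<forall>X\<in>cmatrices k. (cmod (\<O> k X - permanent k X))\<^sup>2 \<le> \<delta>\<^sup>2 * fact k"
    and k: "k \<in> {1..n}" and X: "X \<in> cmatrices k" and \<delta>: "0 < \<delta>"
    and row: "k = 1 \<or> (\<Sum>i=1..k. (cmod (X (1, i)))\<^sup>2) \<le> (real n - 1)\<^sup>2"
  shows "LinearityTest \<O> n k \<delta> X = Accept"
proof (cases "k = 1")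
  case True
  have "(cmod (\<O> 1 X - X (1, 1)))\<^sup>2 \<le> \<delta>\<^sup>2"
    using near k X True permanent_1[of X] by fastforce
  also have "\<dots> \<le> (real n)\<^sup>2 * \<delta>\<^sup>2"
    using k by (simp add: mult_le_cancel_right1)
  finally show ?thesis
    using True by (simp add: LinearityTest_def)
next
  case False
  with k have k2: "2 \<le> k" "k \<le> n" by auto
  let ?S = "\<Sum>i=1..k. X (1, i) * \<O> (k - 1) (minor k X i)"
  let ?s = "\<Sum>i=1..k. cmod (X (1, i))"
  have err: "cmod (\<O> j Y - permanent j Y) \<le> \<delta> * sqrt (fact j)" if "j \<in> {1..n}" "Y \<in> cmatrices j" for j Y
    using near that \<delta> by (intro cmod_le_of_square_le) auto
  \<comment> \<open>Cauchy-Schwarz: the factor \<open>sqrt k\<close> lost here is the one that lifts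
    \<open>sqrt ((k - 1)!)\<close> to \<open>sqrt (k!)\<close> below.\<close>
  have "?s\<^sup>2 \<le> (\<Sum>i=1..k. (cmod (X (1, i)))\<^sup>2) * card {1..k}"
    by (rule sum_squared_le_sum_of_squares)
  also have "\<dots> \<le> (real n - 1)\<^sup>2 * k"
    using row False by (intro mult_mono) auto
  also have "\<dots> = ((real n - 1) * sqrt k)\<^sup>2"
    by (simp add: power_mult_distrib)
  finally have "?s\<^sup>2 \<le> ((real n - 1) * sqrt k)\<^sup>2" .
  moreover have "0 \<le> (real n - 1) * sqrt k"
    using k2 by (intro mult_nonneg_nonneg) auto
  ultimately have s: "?s \<le> (real n - 1) * sqrt k"
    by (rule power2_le_imp_le)
  have fact: "sqrt k * sqrt (fact (k - 1)) = sqrt (fact k)"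
    using k2 by (simp add: fact_reduce[of k] flip: real_sqrt_mult)
  have minor_err: "cmod (X (1, i) * (permanent (k - 1) (minor k X i) - \<O> (k - 1) (minor k X i)))
      \<le> cmod (X (1, i)) * (\<delta> * sqrt (fact (k - 1)))" for i
  proof -
    have "k - 1 \<in> {1..n}"
      using k2 by auto
    from err[OF this minor_in_cmatrices]
    have "cmod (permanent (k - 1) (minor k X i) - \<O> (k - 1) (minor k X i)) \<le> \<delta> * sqrt (fact (k - 1))"
      by (simp only: norm_minus_commute)
    then show ?thesis
      unfolding norm_mult by (rule mult_left_mono) simp
  qed
  \<comment> \<open>Exact permanents satisfy the tested identity, so only oracle errors are
    left.\<close>
  have eq: "\<O> k X - ?S = (\<O> k X - permanent k X) + (\<Sum>i=1..k. X (1, i) * (permanent (k - 1) (minor k X i) - \<O> (k - 1) (minor k X i)))"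
    using k2 by (subst permanent_expand_first_row) (auto simp: right_diff_distrib sum_subtractf)
  have "cmod (\<O> k X - ?S) \<le> cmod (\<O> k X - permanent k X)
      + (\<Sum>i=1..k. cmod (X (1, i) * (permanent (k - 1) (minor k X i) - \<O> (k - 1) (minor k X i))))"
    unfolding eq by (rule order_trans[OF norm_triangle_ineq add_left_mono[OF norm_sum]])
  also have "\<dots> \<le> \<delta> * sqrt (fact k) + (\<Sum>i=1..k. cmod (X (1, i)) * (\<delta> * sqrt (fact (k - 1))))"
    using err[OF k X] minor_err by (rule add_mono[OF _ sum_mono])
  also have "\<dots> = \<delta> * sqrt (fact k) + ?s * (\<delta> * sqrt (fact (k - 1)))"
    by (simp add: sum_distrib_right)
  also have "\<dots> \<le> \<delta> * sqrt (fact k) + ((real n - 1) * sqrt k) * (\<delta> * sqrt (fact (k - 1)))"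
    using s \<delta> by (intro add_left_mono mult_right_mono) auto
  also have "\<dots> = \<delta> * sqrt (fact k) + (real n - 1) * \<delta> * (sqrt k * sqrt (fact (k - 1)))"
    by simp
  also have "\<dots> = real n * \<delta> * sqrt (fact k)"
    unfolding fact by (simp add: algebra_simps)
  finally have "(cmod (\<O> k X - ?S))\<^sup>2 \<le> (real n * \<delta> * sqrt (fact k))\<^sup>2"
    by (intro power_mono) auto
  then show ?thesis
    using False by (simp add: LinearityTest_def power_mult_distrib)
qed

text \<open>The oracle error consumes at most \<open>\<delta> \<le> 1\<close> units of
  \<open>sqrt (k!)\<close>, so \<open>T - 1\<close> of the \<open>T\<close> units remain for the
  permanent.\<close>

lemma TailTest_accept:
  assumes near: "(cmod (\<O> k X - permanent k X))\<^sup>2 \<le> \<delta>\<^sup>2 * fact k" and \<delta>: "0 < \<delta>" "\<delta> \<le> 1"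
    and per: "(cmod (permanent k X))\<^sup>2 \<le> (T - 1)\<^sup>2 * fact k" and T: "T \<ge> 1"
  shows "TailTest \<O> k T X = Accept"
proof -
  have "cmod (\<O> k X) \<le> cmod (\<O> k X - permanent k X) + cmod (permanent k X)"
    using norm_triangle_ineq[of "\<O> k X - permanent k X" "permanent k X"] by simp
  also have "\<dots> \<le> \<delta> * sqrt (fact k) + (T - 1) * sqrt (fact k)"
    using assms by (intro add_mono cmod_le_of_square_le) auto
  also have "\<dots> \<le> 1 * sqrt (fact k) + (T - 1) * sqrt (fact k)"
    using \<delta> by (intro add_right_mono mult_right_mono) auto
  also have "\<dots> = T * sqrt (fact k)"
    by (simp add: algebra_simps)
  finally have "(cmod (\<O> k X))\<^sup>2 \<le> (T * sqrt (fact k))\<^sup>2"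
    by (intro power_mono) auto
  then show ?thesis
    by (simp add: TailTest_def power_mult_distrib)
qed

lemma PTest_threshold_ge:
  assumes "0 < \<delta>" "\<delta> \<le> 1" "0 < c" "c \<le> 1"
  shows "4 * real n \<le> PTest_threshold n \<delta> c"
proof -
  have "\<delta> * sqrt c \<le> 1 * 1"
    using assms by (intro mult_mono) auto
  then show ?thesis
    using assms unfolding PTest_threshold_def
    by (subst pos_le_divide_eq) (auto intro: mult_left_le)
qed

lemma space_PTest_space_run:
  assumes "\<omega> \<in> space (PTest_space n \<delta> c)" "(t, k, r) \<in> PTest_runs n \<delta> c"
  shows "\<omega> (t, k, r) \<in> cmatrices k"
proof -
  have "\<omega> (t, k, r) \<in> space (case (t, k, r) of (t, k, r) \<Rightarrow> gaussian_ensemble k)"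
    using assms unfolding PTest_space_def space_PiM by (rule PiE_mem)
  then show ?thesis by (simp add: space_gaussian_ensemble)
qed

text \<open>The conditions on the samples no longer mention the oracles, so they define measurable
  events whatever the oracles are. Both lower bounds on the acceptance probability start from
  here.\<close>

lemma PTest_accept:
  assumes near: "\<forall>k\<in>{1..n}. \<forall>X\<in>cmatrices k. (cmod (\<O> k X - permanent k X))\<^sup>2 \<le> \<delta>\<^sup>2 * fact k"
    and \<delta>: "0 < \<delta>" "\<delta> \<le> 1" and c: "0 < c" "c \<le> 1"
    and \<omega>: "\<omega> \<in> space (PTest_space n \<delta> c)"
    and lin: "\<And>k r. (Linearity, k, r) \<in> PTest_runs n \<delta> c \<Longrightarrow>
      k = 1 \<or> (\<Sum>i=1..k. (cmod (\<omega> (Linearity, k, r) (1, i)))\<^sup>2) \<le> (real n - 1)\<^sup>2"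
    and tail: "\<And>k r. (Tail, k, r) \<in> PTest_runs n \<delta> c \<Longrightarrow>
      (cmod (permanent k (\<omega> (Tail, k, r))))\<^sup>2 \<le> (PTest_threshold n \<delta> c - 1)\<^sup>2 * fact k"
  shows "PTest \<O> n \<delta> c \<omega> = Accept"
proof -
  have "LinearityTest \<O> n k \<delta> (\<omega> (Linearity, k, r)) = Accept \<and>
      TailTest \<O> k (PTest_threshold n \<delta> c) (\<omega> (Tail, k, r)) = Accept"
    if k: "k \<in> {1..n}" and r: "r \<in> {1..PTest_reps n \<delta> c}" for k r
  proof
    have run: "(t, k, r) \<in> PTest_runs n \<delta> c" for t
      using k r by (simp add: PTest_runs_def)
    have X: "\<omega> (t, k, r) \<in> cmatrices k" for t
      using \<omega> run by (rule space_PTest_space_run)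
    show "LinearityTest \<O> n k \<delta> (\<omega> (Linearity, k, r)) = Accept"
      using near k X \<delta>(1) lin[OF run] by (rule LinearityTest_accept)
    have T: "1 \<le> PTest_threshold n \<delta> c"
      using PTest_threshold_ge[OF \<delta> c, of n] k by simp
    show "TailTest \<O> k (PTest_threshold n \<delta> c) (\<omega> (Tail, k, r)) = Accept"
      using bspec[OF bspec[OF near k] X] \<delta> tail[OF run] T by (rule TailTest_accept)
  qed
  then show ?thesis
    by (auto simp: PTest_def)
qed

section \<open>Union bound over all runs\<close>

lemma (in finite_measure) measure_le_inner_prob:
  assumes "E \<in> sets M" "E \<subseteq> A"
  shows "measure M E \<le> inner_prob M A"
  unfolding inner_prob_def
proof (rule cSUP_upper)
  show "E \<in> {E \<in> sets M. E \<subseteq> A}"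
    using assms by simp
  show "bdd_above (measure M ` {E \<in> sets M. E \<subseteq> A})"
    by (rule bdd_aboveI2[of _ _ "measure M (space M)"]) (rule bounded_measure)
qed

lemma product_prob_space_gaussian_ensemble:
  "product_prob_space (\<lambda>(t :: test_kind, k, r :: nat). gaussian_ensemble k)"
proof -
  have P: "prob_space (case z of (t :: test_kind, k, r :: nat) \<Rightarrow> gaussian_ensemble k)" for z
    by (auto intro: prob_space_gaussian_ensemble split: prod.split)
  then interpret P: prob_space "case z of (t :: test_kind, k, r :: nat) \<Rightarrow> gaussian_ensemble k" for z .
  show ?thesis by unfold_locales
qed

lemma UNIV_test_kind: "UNIV = {Linearity, Tail}"
  using test_kind.exhaust by auto

lemma finite_PTest_runs: "finite (PTest_runs n \<delta> c)"
  by (simp add: PTest_runs_def UNIV_test_kind)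

lemma PTest_space_run_measure:
  assumes "(t, k, r) \<in> PTest_runs n \<delta> c" "B \<in> sets (gaussian_ensemble k)"
  shows "{\<omega> \<in> space (PTest_space n \<delta> c). \<omega> (t, k, r) \<in> B} \<in> sets (PTest_space n \<delta> c)"
    and "measure (PTest_space n \<delta> c) {\<omega> \<in> space (PTest_space n \<delta> c). \<omega> (t, k, r) \<in> B} = measure (gaussian_ensemble k) B"
proof -
  interpret product_prob_space "\<lambda>(t :: test_kind, k, r :: nat). gaussian_ensemble k" "PTest_runs n \<delta> c"
    by (rule product_prob_space_gaussian_ensemble)
  show "measure (PTest_space n \<delta> c) {\<omega> \<in> space (PTest_space n \<delta> c). \<omega> (t, k, r) \<in> B} = measure (gaussian_ensemble k) B"
    using emeasure_PiM_Collect_single[OF assms(1), of B] assms(2)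
    by (simp add: PTest_space_def measure_def)
  have "(\<lambda>\<omega>. \<omega> (t, k, r)) \<in> PTest_space n \<delta> c \<rightarrow>\<^sub>M gaussian_ensemble k"
    using measurable_component_singleton[OF assms(1), of "\<lambda>(t, k, r). gaussian_ensemble k"]
    by (simp add: PTest_space_def)
  from measurable_sets[OF this assms(2)]
  show "{\<omega> \<in> space (PTest_space n \<delta> c). \<omega> (t, k, r) \<in> B} \<in> sets (PTest_space n \<delta> c)"
    by (simp add: vimage_def Int_def conj_commute)
qed

lemma PTest_accept_prob_ge_union_bound:
  assumes near: "\<forall>k\<in>{1..n}. \<forall>X\<in>cmatrices k. (cmod (\<O> k X - permanent k X))\<^sup>2 \<le> \<delta>\<^sup>2 * fact k"
    and \<delta>: "0 < \<delta>" "\<delta> \<le> 1" and c: "0 < c" "c \<le> 1"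
  shows "PTest_accept_prob \<O> n \<delta> c \<ge> 1 - real (PTest_reps n \<delta> c) *
    (\<Sum>k=1..n. 2 ^ k * exp (- (real n - 1)\<^sup>2 / 2) + (real k + 1) / (PTest_threshold n \<delta> c - 1) ^ 4)"
proof -
  let ?M = "PTest_space n \<delta> c" and ?T = "PTest_threshold n \<delta> c" and ?R = "PTest_runs n \<delta> c"
  interpret prob_space ?M by (rule prob_space_PTest_space)
  define B where "B t k = (case t of
      Linearity \<Rightarrow> {X \<in> space (gaussian_ensemble k). (\<Sum>i=1..k. (cmod (X (1, i)))\<^sup>2) > (real n - 1)\<^sup>2}
    | Tail \<Rightarrow> {X \<in> space (gaussian_ensemble k). (cmod (permanent k X))\<^sup>2 > (?T - 1)\<^sup>2 * fact k})" for t k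
  define b where "b t k = (case t of Linearity \<Rightarrow> 2 ^ k * exp (- (real n - 1)\<^sup>2 / 2)
    | Tail \<Rightarrow> (real k + 1) / (?T - 1) ^ 4)" for t k
  have B: "B t k \<in> sets (gaussian_ensemble k)" for t k
    by (cases t) (simp_all only: B_def test_kind.case, measurable)
  have b: "measure (gaussian_ensemble k) (B t k) \<le> b t k" if "k \<in> {1..n}" for t k
  proof (cases t)
    case Linearity
    then show ?thesis
      using first_row_tail_bound[of k "(real n - 1)\<^sup>2"] that by (simp add: B_def b_def)
  next
    case Tail
    have "?T - 1 > 0"
      using PTest_threshold_ge[OF \<delta> c, of n] that by simp
    with Tail show ?thesis
      using permanent_tail_bound[of "?T - 1" k] by (simp add: B_def b_def)
  qed
  \<comment> \<open>A run is bad when its own sample violates the sufficient condition. The marginal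
    of a run is its Gaussian ensemble, so the one-matrix tail bounds apply to it.\<close>
  define bad where "bad = (\<lambda>(t, k, r). {\<omega> \<in> space ?M. \<omega> (t, k, r) \<in> B t k})"
  have bad: "bad z \<in> sets ?M" if "z \<in> ?R" for z
    using that PTest_space_run_measure(1)[OF _ B] by (auto simp: bad_def split: prod.split)
  have "1 - (\<Sum>z\<in>?R. prob (bad z)) \<le> 1 - prob (\<Union>z\<in>?R. bad z)"
    using bad by (intro diff_left_mono finite_measure_subadditive_finite finite_PTest_runs) auto
  also have "\<dots> = prob (space ?M - (\<Union>z\<in>?R. bad z))"
    using bad finite_PTest_runs by (intro prob_compl[symmetric]) auto
  also have "\<dots> \<le> PTest_accept_prob \<O> n \<delta> c"
    unfolding PTest_accept_prob_def
  proof (rule measure_le_inner_prob)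
    show "space ?M - (\<Union>z\<in>?R. bad z) \<in> sets ?M"
      using bad finite_PTest_runs by (intro sets.Diff sets.top sets.finite_UN)
    show "space ?M - (\<Union>z\<in>?R. bad z) \<subseteq> {\<omega> \<in> space ?M. PTest \<O> n \<delta> c \<omega> = Accept}"
    proof
      fix \<omega> assume \<omega>: "\<omega> \<in> space ?M - (\<Union>z\<in>?R. bad z)"
      have good: "\<omega> (t, k, r) \<notin> B t k" and mem: "\<omega> (t, k, r) \<in> space (gaussian_ensemble k)" if "(t, k, r) \<in> ?R" for t k r
      proof -
        show "\<omega> (t, k, r) \<in> space (gaussian_ensemble k)"
          using space_PTest_space_run[OF _ that] \<omega> by (simp add: space_gaussian_ensemble)
        have "\<omega> \<notin> bad (t, k, r)"
          using \<omega> that by blast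
        then show "\<omega> (t, k, r) \<notin> B t k"
          using \<omega> by (simp add: bad_def)
      qed
      have "PTest \<O> n \<delta> c \<omega> = Accept"
      proof (rule PTest_accept[OF near \<delta> c])
        show "\<omega> \<in> space ?M" using \<omega> by simp
        show "k = 1 \<or> (\<Sum>i=1..k. (cmod (\<omega> (Linearity, k, r) (1, i)))\<^sup>2) \<le> (real n - 1)\<^sup>2"
          if "(Linearity, k, r) \<in> ?R" for k r
          using good[OF that] mem[OF that] by (simp add: B_def not_less)
        show "(cmod (permanent k (\<omega> (Tail, k, r))))\<^sup>2 \<le> (?T - 1)\<^sup>2 * fact k"
          if "(Tail, k, r) \<in> ?R" for k r
          using good[OF that] mem[OF that] by (simp add: B_def not_less)
      qed
      with \<omega> show "\<omega> \<in> {\<omega> \<in> space ?M. PTest \<O> n \<delta> c \<omega> = Accept}" by simp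
    qed
  qed
  finally have "1 - (\<Sum>z\<in>?R. prob (bad z)) \<le> PTest_accept_prob \<O> n \<delta> c" .
  moreover have "(\<Sum>z\<in>?R. prob (bad z)) \<le> (\<Sum>(t, k, r)\<in>?R. b t k)"
  proof (rule sum_mono)
    fix z assume z: "z \<in> ?R"
    obtain t k r where tkr: "z = (t, k, r)" by (cases z)
    have "prob (bad z) = measure (gaussian_ensemble k) (B t k)"
      unfolding tkr bad_def prod.case by (rule PTest_space_run_measure(2)[OF z[unfolded tkr] B])
    also have "\<dots> \<le> b t k"
      using z by (intro b) (simp add: PTest_runs_def tkr)
    finally show "prob (bad z) \<le> (case z of (t, k, r) \<Rightarrow> b t k)" by (simp only: tkr prod.case)
  qed
  moreover have "(\<Sum>(t, k, r)\<in>?R. b t k) = (\<Sum>t\<in>UNIV. \<Sum>k=1..n. \<Sum>r=1..PTest_reps n \<delta> c. b t k)"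
    by (simp only: PTest_runs_def sum.cartesian_product)
  moreover have "\<dots> = (\<Sum>t\<in>{Linearity, Tail}. \<Sum>k=1..n. real (PTest_reps n \<delta> c) * b t k)"
    by (simp add: UNIV_test_kind)
  moreover have "\<dots> = real (PTest_reps n \<delta> c) * (\<Sum>k=1..n. b Linearity k + b Tail k)"
    by (simp add: sum.distrib sum_distrib_left distrib_left)
  ultimately have "1 - real (PTest_reps n \<delta> c) * (\<Sum>k=1..n. b Linearity k + b Tail k) \<le> PTest_accept_prob \<O> n \<delta> c"
    by linarith
  then show ?thesis
    by (simp only: b_def test_kind.case)
qed

section \<open>Acceptance when all entries are small\<close>

lemma cmod_permanent_le:
  assumes "\<And>i j. i \<in> {1..k} \<Longrightarrow> j \<in> {1..k} \<Longrightarrow> cmod (X (i, j)) \<le> e"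
  shows "cmod (permanent k X) \<le> fact k * e ^ k"
proof -
  have "cmod (permanent k X) \<le> (\<Sum>\<pi> | \<pi> permutes {1..k}. e ^ k)"
    unfolding permanent_def
  proof (rule sum_norm_le)
    fix \<pi> assume "\<pi> \<in> {\<pi>. \<pi> permutes {1..k}}"
    then have \<pi>: "\<pi> permutes {1..k}" by simp
    have "cmod (\<Prod>i=1..k. X (i, \<pi> i)) = (\<Prod>i=1..k. cmod (X (i, \<pi> i)))"
      by (simp add: prod_norm)
    also have "\<dots> \<le> (\<Prod>i=1..k. e)"
    proof (rule prod_mono)
      fix i assume i: "i \<in> {1..k}"
      show "0 \<le> cmod (X (i, \<pi> i)) \<and> cmod (X (i, \<pi> i)) \<le> e"
        using assms[OF i iffD2[OF permutes_in_image[OF \<pi>] i]] by simp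
    qed
    also have "\<dots> = e ^ k" by simp
    finally show "cmod (\<Prod>i=1..k. X (i, \<pi> i)) \<le> e ^ k" .
  qed
  also have "\<dots> = fact k * e ^ k"
    by (simp add: card_permutations[OF refl])
  finally show ?thesis .
qed

text \<open>With entries of size at most \<open>1 / n\<close>, a row has squared norm at most
  \<open>k / n^2 \<le> 1 \<le> (n - 1)^2\<close> once \<open>n \<ge> 2\<close>, and
  \<open>|Per| \<le> k! / n^k \<le> 1 \<le> T - 1\<close>. The exponent counts \<open>n * n\<close>
  entries for each of the \<open>2 n d\<close> runs, where \<open>d\<close> is the number of
  repetitions.\<close>

lemma PTest_accept_prob_ge_small_entries:
  assumes near: "\<forall>k\<in>{1..n}. \<forall>X\<in>cmatrices k. (cmod (\<O> k X - permanent k X))\<^sup>2 \<le> \<delta>\<^sup>2 * fact k"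
    and \<delta>: "0 < \<delta>" "\<delta> \<le> 1" and c: "0 < c" "c \<le> 1"
  shows "PTest_accept_prob \<O> n \<delta> c
    \<ge> measure std_complex_gaussian (cball 0 (1 / real n)) ^ (n * n * (2 * (n * PTest_reps n \<delta> c)))"
proof -
  let ?M = "PTest_space n \<delta> c" and ?T = "PTest_threshold n \<delta> c" and ?R = "PTest_runs n \<delta> c"
  let ?B = "cball 0 (1 / real n) :: complex set"
  interpret std: prob_space std_complex_gaussian by (rule prob_space_std_complex_gaussian)
  interpret prob_space ?M by (rule prob_space_PTest_space)
  interpret G: product_prob_space "\<lambda>_ :: nat \<times> nat. std_complex_gaussian" I for I
    by (rule product_prob_space_std_complex_gaussian)
  interpret P: product_prob_space "\<lambda>(t :: test_kind, k, r :: nat). gaussian_ensemble k" ?R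
    by (rule product_prob_space_gaussian_ensemble)
  define q where "q = measure std_complex_gaussian ?B"
  have q: "0 \<le> q" "q \<le> 1"
    by (auto simp: q_def)
  define A where "A k = ({1..k} \<times> {1..k}) \<rightarrow>\<^sub>E ?B" for k :: nat
  define E where "E = (\<Pi>\<^sub>E z\<in>?R. case z of (t, k, r) \<Rightarrow> A k)"
  have B: "?B \<in> sets std_complex_gaussian"
    by (simp add: sets_std_complex_gaussian)
  have A: "A k \<in> sets (gaussian_ensemble k)" for k
    unfolding A_def gaussian_ensemble_def using B by (intro sets_PiM_I_finite) auto
  have measure_A: "measure (gaussian_ensemble k) (A k) = q ^ (k * k)" for k
  proof -
    have "measure (gaussian_ensemble k) (A k) = (\<Prod>ij\<in>{1..k} \<times> {1..k}. q)"
      using G.measure_PiM_emb[of "{1..k} \<times> {1..k}" "{1..k} \<times> {1..k}" "\<lambda>_. ?B"] B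
      by (simp add: A_def gaussian_ensemble_def q_def prod_emb_PiE_same_index space_std_complex_gaussian)
    then show ?thesis by (simp add: card_cartesian_product)
  qed
  have A': "(case z of (t, k, r) \<Rightarrow> A k) \<in> sets (case z of (t, k, r) \<Rightarrow> gaussian_ensemble k)"
    for z :: "test_kind \<times> nat \<times> nat"
    using A by (simp split: prod.split)
  have E: "E \<in> sets ?M"
    unfolding E_def PTest_space_def using finite_PTest_runs A' by (intro sets_PiM_I_finite)
  have "card ?R = 2 * (n * PTest_reps n \<delta> c)"
    by (simp add: PTest_runs_def card_cartesian_product UNIV_test_kind)
  then have "q ^ (n * n * (2 * (n * PTest_reps n \<delta> c))) = (\<Prod>z\<in>?R. q ^ (n * n))"
    unfolding power_mult[of q "n * n"] by simp
  \<comment> \<open>Smaller matrices have fewer entries, and \<open>q \<le> 1\<close>, so charging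
    every run with \<open>n * n\<close> entries only lowers the bound.\<close>
  also have "\<dots> \<le> (\<Prod>z\<in>?R. case z of (t, k, r) \<Rightarrow> q ^ (k * k))"
  proof (rule prod_mono)
    fix z assume z: "z \<in> ?R"
    obtain t k r where tkr: "z = (t, k, r)" by (cases z)
    have "k * k \<le> n * n"
      using z by (intro mult_le_mono) (auto simp: PTest_runs_def tkr)
    then show "0 \<le> q ^ (n * n) \<and> q ^ (n * n) \<le> (case z of (t, k, r) \<Rightarrow> q ^ (k * k))"
      using q by (simp add: tkr power_decreasing)
  qed
  also have "\<dots> = (\<Prod>z\<in>?R. measure (case z of (t, k, r) \<Rightarrow> gaussian_ensemble k) (case z of (t, k, r) \<Rightarrow> A k))"
    by (intro prod.cong) (auto simp: measure_A)
  also have "\<dots> = prob E"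
  proof -
    have "E \<subseteq> space (PiM ?R (\<lambda>(t, k, r). gaussian_ensemble k))"
      using sets.sets_into_space[OF E] by (simp add: PTest_space_def)
    then have "prod_emb ?R (\<lambda>(t, k, r). gaussian_ensemble k) ?R E = E"
      by (intro prod_emb_id) (simp add: space_PiM)
    then show ?thesis
      using P.measure_PiM_emb[OF order_refl finite_PTest_runs A']
      by (simp add: E_def PTest_space_def)
  qed
  also have "\<dots> \<le> PTest_accept_prob \<O> n \<delta> c"
    unfolding PTest_accept_prob_def
  proof (rule measure_le_inner_prob[OF E subsetI])
    fix \<omega> assume \<omega>: "\<omega> \<in> E"
    have small: "cmod (\<omega> (t, k, r) (i, j)) \<le> 1 / n"
      if "(t, k, r) \<in> ?R" "i \<in> {1..k}" "j \<in> {1..k}" for t k r i j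
    proof -
      have "\<omega> (t, k, r) \<in> A k"
        using \<omega> that(1) unfolding E_def by (auto dest: PiE_mem)
      then have "\<omega> (t, k, r) (i, j) \<in> ?B"
        unfolding A_def by (rule PiE_mem) (rule SigmaI[OF that(2,3)])
      then show ?thesis by simp
    qed
    have space: "\<omega> \<in> space ?M"
      using sets.sets_into_space[OF E] \<omega> by blast
    have "PTest \<O> n \<delta> c \<omega> = Accept"
    proof (rule PTest_accept[OF near \<delta> c space])
      fix k r assume run: "(Linearity, k, r) \<in> ?R"
      then have k: "1 \<le> k" "k \<le> n" by (auto simp: PTest_runs_def)
      show "k = 1 \<or> (\<Sum>i=1..k. (cmod (\<omega> (Linearity, k, r) (1, i)))\<^sup>2) \<le> (real n - 1)\<^sup>2"
      proof (cases "k = 1")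
        case False
        with k have n: "2 \<le> n" by simp
        have "(\<Sum>i=1..k. (cmod (\<omega> (Linearity, k, r) (1, i)))\<^sup>2) \<le> (\<Sum>i=1..k. (1 / real n)\<^sup>2)"
          using small[OF run] k by (intro sum_mono power_mono) auto
        also have "\<dots> = real k / (real n)\<^sup>2"
          by (simp add: power_divide)
        also have "\<dots> \<le> 1"
          using k n self_le_power[of "real n" 2] by simp
        also have "\<dots> \<le> (real n - 1)\<^sup>2"
          using n by (intro one_le_power) simp
        finally show ?thesis ..
      qed simp
    next
      fix k r assume run: "(Tail, k, r) \<in> ?R"
      then have k: "1 \<le> k" "k \<le> n" by (auto simp: PTest_runs_def)
      have "cmod (permanent k (\<omega> (Tail, k, r))) \<le> fact k * (1 / real n) ^ k"
        using small[OF run] by (rule cmod_permanent_le)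
      also have "\<dots> \<le> 1"
      proof -
        have "fact k \<le> real (k ^ k)"
          by (rule fact_le_power)
        also have "\<dots> \<le> real n ^ k"
          using k by (simp add: power_mono)
        finally show ?thesis
          using k by (simp add: power_divide)
      qed
      finally have "(cmod (permanent k (\<omega> (Tail, k, r))))\<^sup>2 \<le> 1"
        by (simp add: power_le_one)
      also have "1 \<le> (?T - 1)\<^sup>2 * fact k"
      proof -
        have "1 \<le> ?T - 1"
          using PTest_threshold_ge[OF \<delta> c, of n] k by simp
        then have "1 * 1 \<le> (?T - 1)\<^sup>2 * fact k"
          by (intro mult_mono one_le_power fact_ge_1) auto
        then show ?thesis by simp
      qed
      finally show "(cmod (permanent k (\<omega> (Tail, k, r))))\<^sup>2 \<le> (?T - 1)\<^sup>2 * fact k" .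
    qed
    with space show "\<omega> \<in> {\<omega> \<in> space ?M. PTest \<O> n \<delta> c \<omega> = Accept}" by simp
  qed
  finally show ?thesis
    unfolding q_def .
qed

section \<open>Numerical estimates in large dimension\<close>

text \<open>The exponent equals \<open>- n^2 / 4 + n - 1 / 2\<close>, which beats
  \<open>n^3 2^n\<close>. The term \<open>n^2 / 4\<close> pays for the dependence on
  \<open>\<delta>\<close> and \<open>c\<close> in the number of runs.\<close>

lemma eventually_linearity_failure_small:
  "\<forall>\<^sub>F n :: nat in at_top.
     193 * real n ^ 3 * 2 ^ n * exp ((real n)\<^sup>2 / 4 - (real n - 1)\<^sup>2 / 2) \<le> 1 / 4"
  by real_asymp

text \<open>Rounding up costs at most 1, which one further multiple of
  \<open>n^2 / (\<delta>^4 c) \<ge> 1\<close> absorbs: 192 becomes 193.\<close>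

lemma PTest_reps_le:
  assumes "1 \<le> n" "0 < \<delta>" "\<delta> \<le> 1" "0 < c" "c \<le> 1"
  shows "real (PTest_reps n \<delta> c) \<le> 193 * (real n)\<^sup>2 / (\<delta> ^ 4 * c)"
proof -
  let ?D = "(real n)\<^sup>2 / (\<delta> ^ 4 * c)"
  have "\<delta> ^ 4 * c \<le> 1 * 1"
    using assms by (intro mult_mono power_le_one) auto
  moreover have "1 \<le> (real n)\<^sup>2"
    using assms by simp
  ultimately have "\<delta> ^ 4 * c \<le> (real n)\<^sup>2"
    by linarith
  then have "1 \<le> ?D"
    using assms by simp
  have "real (PTest_reps n \<delta> c) \<le> 192 * ?D + 1"
    unfolding PTest_reps_def using \<open>1 \<le> ?D\<close> by (simp add: of_nat_nat)
  with \<open>1 \<le> ?D\<close> show ?thesis by simp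
qed

text \<open>For \<open>n \<ge> 10\<close> one has \<open>n + 3 \<le> 13 n / 10\<close> and
  \<open>T \<ge> 40\<close>, hence \<open>T - 1 \<ge> 39 T / 40\<close>, whose fourth power is at
  least \<open>9 T^4 / 10\<close>. All powers of \<open>n\<close> and \<open>\<delta>\<close> then
  cancel, leaving \<open>193 * 13 / (18 * 256) < 3 / 4\<close> times \<open>c\<close>.\<close>

lemma tail_failure_le:
  assumes n: "10 \<le> n" and \<delta>: "0 < \<delta>" "\<delta> \<le> 1" and c: "0 < c" "c \<le> 1"
  shows "real (PTest_reps n \<delta> c) * (\<Sum>k=1..n. (real k + 1) / (PTest_threshold n \<delta> c - 1) ^ 4) \<le> 3 / 4 * c"
proof -
  let ?T = "PTest_threshold n \<delta> c"
  have sum: "(\<Sum>k=1..n. real k + 1) = real n * (real n + 3) / 2"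
    by (induction n) (auto simp: field_simps)
  have "real n * (real n + 3) \<le> real n * (13 / 10 * real n)"
    using n by (intro mult_left_mono) auto
  then have sum_le: "(\<Sum>k=1..n. real k + 1) \<le> 13 / 20 * (real n)\<^sup>2"
    unfolding sum by (simp add: power2_eq_square)
  have T: "40 \<le> ?T"
    using PTest_threshold_ge[OF \<delta> c, of n] n by linarith
  have T4: "?T ^ 4 = 256 * real n ^ 4 / (\<delta> ^ 4 * c\<^sup>2)"
  proof -
    have "sqrt c ^ 4 = c\<^sup>2"
      using c power_mult[of "sqrt c" 2 2] by simp
    then show ?thesis
      by (simp add: PTest_threshold_def power_divide power_mult_distrib)
  qed
  have "(39 / 40 * ?T) ^ 4 \<le> (?T - 1) ^ 4"
    using T by (intro power_mono) auto
  then have "(39 / 40) ^ 4 * ?T ^ 4 \<le> (?T - 1) ^ 4"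
    by (simp only: power_mult_distrib)
  moreover have "(9 / 10 :: real) * ?T ^ 4 \<le> (39 / 40) ^ 4 * ?T ^ 4"
    by (intro mult_right_mono) (auto simp: power_divide)
  ultimately have T1: "9 / 10 * ?T ^ 4 \<le> (?T - 1) ^ 4"
    by linarith
  have "real (PTest_reps n \<delta> c) * (\<Sum>k=1..n. (real k + 1) / (?T - 1) ^ 4)
      = real (PTest_reps n \<delta> c) * ((\<Sum>k=1..n. real k + 1) / (?T - 1) ^ 4)"
    by (simp only: sum_divide_distrib)
  also have "\<dots> \<le> (193 * (real n)\<^sup>2 / (\<delta> ^ 4 * c)) * (13 / 20 * (real n)\<^sup>2 / (9 / 10 * ?T ^ 4))"
  proof (intro mult_mono frac_le)
    show "real (PTest_reps n \<delta> c) \<le> 193 * (real n)\<^sup>2 / (\<delta> ^ 4 * c)"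
      using n \<delta> c by (intro PTest_reps_le) auto
    show "0 < 9 / 10 * ?T ^ 4"
      using T by simp
    show "0 \<le> (\<Sum>k=1..n. real k + 1) / (?T - 1) ^ 4"
      by (intro divide_nonneg_nonneg sum_nonneg) auto
  qed (use sum_le T1 \<delta> c in auto)
  also have "\<dots> = 193 * 13 / (18 * 256) * c"
    unfolding T4 using n \<delta> c by (simp add: field_simps power2_eq_square power4_eq_xxxx)
  also have "\<dots> \<le> 3 / 4 * c"
    using c by simp
  finally show ?thesis .
qed

lemma linearity_failure_le:
  assumes n: "1 \<le> n" and \<delta>: "0 < \<delta>" "\<delta> \<le> 1" and c: "0 < c" "c \<le> 1"
    and ln: "ln (1 / (\<delta> * c)) \<le> (real n)\<^sup>2 / 16"
    and small: "193 * real n ^ 3 * 2 ^ n * exp ((real n)\<^sup>2 / 4 - (real n - 1)\<^sup>2 / 2) \<le> 1 / 4"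
  shows "real (PTest_reps n \<delta> c) * (\<Sum>k=1..n. 2 ^ k * exp (- (real n - 1)\<^sup>2 / 2)) \<le> 1 / 4 * c"
proof -
  have "1 / (\<delta> * c) = exp (ln (1 / (\<delta> * c)))"
    using \<delta> c by simp
  also have "\<dots> \<le> exp ((real n)\<^sup>2 / 16)"
    using ln by simp
  finally have "(1 / (\<delta> * c)) ^ 4 \<le> exp ((real n)\<^sup>2 / 16) ^ 4"
    using \<delta> c by (intro power_mono) auto
  also have "\<dots> = exp ((real n)\<^sup>2 / 4)"
    by (simp flip: exp_of_nat_mult)
  finally have "(1 / (\<delta> * c)) ^ 4 \<le> exp ((real n)\<^sup>2 / 4)" .
  \<comment> \<open>The fourth power of the hypothesis controls \<open>1 / (\<delta>^4 c^4)\<close>,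
    which dominates since \<open>c \<le> 1\<close>. The exponent 2 of \<open>c\<close> is the one
    wanted: \<open>1 / (\<delta>^4 c)\<close> is \<open>c\<close> times this quantity, and that
    \<open>c\<close> survives into the final bound.\<close>
  moreover have "1 / (\<delta> ^ 4 * c\<^sup>2) \<le> (1 / (\<delta> * c)) ^ 4"
  proof -
    have "c ^ 4 \<le> c ^ 2"
      using c by (intro power_decreasing) auto
    then have "\<delta> ^ 4 * c ^ 4 \<le> \<delta> ^ 4 * c\<^sup>2"
      using \<delta> by (intro mult_left_mono) auto
    then show ?thesis
      using \<delta> c by (simp add: power_divide power_mult_distrib frac_le)
  qed
  ultimately have inv: "1 / (\<delta> ^ 4 * c\<^sup>2) \<le> exp ((real n)\<^sup>2 / 4)"
    by linarith
  let ?e = "exp (- (real n - 1)\<^sup>2 / 2)"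
  have "(\<Sum>k=1..n. 2 ^ k * ?e) \<le> (\<Sum>k=1..n. 2 ^ n * ?e)"
    by (intro sum_mono mult_right_mono power_increasing) auto
  then have "(\<Sum>k=1..n. 2 ^ k * ?e) \<le> real n * (2 ^ n * ?e)"
    by simp
  then have "real (PTest_reps n \<delta> c) * (\<Sum>k=1..n. 2 ^ k * ?e)
      \<le> (193 * (real n)\<^sup>2 / (\<delta> ^ 4 * c)) * (real n * (2 ^ n * ?e))"
    using \<delta> c by (intro mult_mono PTest_reps_le n \<delta> c sum_nonneg) auto
  also have "\<dots> = c * (193 * real n ^ 3 * 2 ^ n * ?e) * (1 / (\<delta> ^ 4 * c\<^sup>2))"
    using \<delta> c by (simp add: field_simps power2_eq_square power3_eq_cube)
  also have "\<dots> \<le> c * (193 * real n ^ 3 * 2 ^ n * ?e) * exp ((real n)\<^sup>2 / 4)"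
    using inv c by (intro mult_left_mono) auto
  also have "\<dots> = c * (193 * real n ^ 3 * 2 ^ n * (exp ((real n)\<^sup>2 / 4) * ?e))"
    by (simp only: ac_simps)
  also have "exp ((real n)\<^sup>2 / 4) * ?e = exp ((real n)\<^sup>2 / 4 - (real n - 1)\<^sup>2 / 2)"
    by (simp flip: exp_add)
  also have "c * (193 * real n ^ 3 * 2 ^ n * exp ((real n)\<^sup>2 / 4 - (real n - 1)\<^sup>2 / 2)) \<le> c * (1 / 4)"
    using small c by (intro mult_left_mono) auto
  finally show ?thesis by simp
qed

lemma ln_le_of_sqrt_bound:
  fixes C L x :: real
  assumes "C * sqrt L \<le> x" "0 < C" "0 \<le> L"
  shows "L \<le> x\<^sup>2 / C\<^sup>2"
proof -
  have "sqrt L \<le> x / C"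
    using assms by (simp add: pos_le_divide_eq mult.commute)
  then have "(sqrt L)\<^sup>2 \<le> (x / C)\<^sup>2"
    using assms(3) by (intro power_mono) auto
  then show ?thesis
    using assms(3) by (simp add: power_divide)
qed

section \<open>Choice of the constant\<close>

text \<open>For fixed \<open>n\<close> a large \<open>C\<close> forces \<open>\<delta>\<close> and
  \<open>c\<close> close to 1. This bounds the number of runs, so the acceptance probability has a
  positive lower bound independent of \<open>\<delta>\<close>, \<open>c\<close> and the oracles. The
  form with eventually all \<open>C\<close> lets finitely many \<open>n\<close> share one
  constant.\<close>

lemma PTest_accept_prob_fixed_n:
  assumes n: "1 \<le> n"
  shows "\<forall>\<^sub>F C in at_top. \<forall>\<delta> c \<O>. 0 < \<delta> \<and> \<delta> \<le> 1 \<and> 0 < c \<and> c \<le> 1 \<and>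
       real n \<ge> C * sqrt (ln (1 / (\<delta> * c))) \<and>
       (\<forall>k\<in>{1..n}. \<forall>X\<in>cmatrices k. (cmod (\<O> k X - permanent k X))\<^sup>2 \<le> \<delta>\<^sup>2 * fact k)
       \<longrightarrow> PTest_accept_prob \<O> n \<delta> c \<ge> 1 - c"
proof -
  interpret prob_space std_complex_gaussian by (rule prob_space_std_complex_gaussian)
  define q where "q = measure std_complex_gaussian (cball 0 (1 / real n))"
  have q: "0 < q" "q \<le> 1"
    using n std_complex_gaussian_cball_pos[of "1 / real n"] by (auto simp: q_def)
  \<comment> \<open>\<open>6144 = 192 * 32\<close>, the number of repetitions per \<open>n^2\<close>
    when \<open>\<delta>\<close> and \<open>c\<close> are at least 1/2.\<close>
  define p where "p = q ^ (n * n * (2 * (n * (6144 * n\<^sup>2))))"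
  \<comment> \<open>The bound \<open>ln 2\<close> keeps \<open>\<delta>\<close> and \<open>c\<close>
    above 1/2, and the bound \<open>p\<close> yields
    \<open>1 - c \<le> - ln c \<le> p\<close>.\<close>
  have "0 < min p (ln 2)"
    using q by (simp add: p_def)
  moreover have "((\<lambda>C::real. (real n)\<^sup>2 / C\<^sup>2) \<longlongrightarrow> 0) at_top"
    by real_asymp
  ultimately have "\<forall>\<^sub>F C in at_top. (real n)\<^sup>2 / C\<^sup>2 < min p (ln 2)"
    by (simp only: order_tendstoD(2))
  then show ?thesis
    using eventually_gt_at_top[of 0]
  proof eventually_elim
    case (elim C)
    show ?case
    proof (intro allI impI, elim conjE)
      fix \<delta> c :: real and \<O> :: "nat \<Rightarrow> cmatrix \<Rightarrow> complex"
      assume \<delta>: "0 < \<delta>" "\<delta> \<le> 1" and c: "0 < c" "c \<le> 1"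
        and large: "C * sqrt (ln (1 / (\<delta> * c))) \<le> real n"
        and near: "\<forall>k\<in>{1..n}. \<forall>X\<in>cmatrices k. (cmod (\<O> k X - permanent k X))\<^sup>2 \<le> \<delta>\<^sup>2 * fact k"
      have L: "ln (1 / (\<delta> * c)) = - ln \<delta> - ln c"
        using \<delta> c by (simp add: ln_div ln_mult)
      have ln: "ln \<delta> \<le> 0" "ln c \<le> 0"
        using \<delta> c by auto
      have "ln (1 / (\<delta> * c)) \<le> (real n)\<^sup>2 / C\<^sup>2"
        using large elim(2) L ln by (intro ln_le_of_sqrt_bound) auto
      then have less: "- ln \<delta> - ln c < p" "- ln \<delta> - ln c < ln 2"
        using elim(1) unfolding L by auto
      have half: "1 / 2 \<le> x" if "- ln x < ln 2" "0 < x" for x :: real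
      proof -
        have "ln (1 / 2) < ln x"
          using that by (simp add: ln_div)
        then show ?thesis
          using that by simp
      qed
      have "1 / 2 \<le> \<delta>" "1 / 2 \<le> c"
        using half[of \<delta>] half[of c] less(2) ln \<delta> c by linarith+
      then have "(1 / 2) ^ 4 * (1 / 2) \<le> \<delta> ^ 4 * c"
        by (intro mult_mono power_mono) auto
      then have "192 * (real n)\<^sup>2 / (\<delta> ^ 4 * c) \<le> 192 * (real n)\<^sup>2 / (1 / 32)"
        by (intro divide_left_mono) (auto simp: power_divide \<delta> c)
      then have "\<lceil>192 * (real n)\<^sup>2 / (\<delta> ^ 4 * c)\<rceil> \<le> int (6144 * n\<^sup>2)"
        by (simp add: ceiling_le_iff)
      then have reps: "PTest_reps n \<delta> c \<le> 6144 * n\<^sup>2"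
        unfolding PTest_reps_def by linarith
      have "1 - c \<le> - ln c"
        using ln_le_minus_one[OF c(1)] by linarith
      also have "\<dots> \<le> p"
        using less(1) ln by linarith
      also have "\<dots> \<le> q ^ (n * n * (2 * (n * PTest_reps n \<delta> c)))"
        unfolding p_def using q reps by (intro power_decreasing mult_le_mono) auto
      also have "\<dots> \<le> PTest_accept_prob \<O> n \<delta> c"
        unfolding q_def by (rule PTest_accept_prob_ge_small_entries[OF near \<delta> c])
      finally show "1 - c \<le> PTest_accept_prob \<O> n \<delta> c" .
    qed
  qed
qed

text \<open>The failure budget \<open>c\<close> is split into \<open>c / 4\<close> for the linearity
  tests and \<open>3 c / 4\<close> for the tail tests; \<open>C \<ge> 4\<close> supplies the bound
  \<open>n^2 / 16\<close> on the logarithm.\<close>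

lemma PTest_accept_prob_large_n:
  assumes n: "10 \<le> n" and C: "4 \<le> C"
    and small: "193 * real n ^ 3 * 2 ^ n * exp ((real n)\<^sup>2 / 4 - (real n - 1)\<^sup>2 / 2) \<le> 1 / 4"
    and \<delta>: "0 < \<delta>" "\<delta> \<le> 1" and c: "0 < c" "c \<le> 1"
    and large: "C * sqrt (ln (1 / (\<delta> * c))) \<le> real n"
    and near: "\<forall>k\<in>{1..n}. \<forall>X\<in>cmatrices k. (cmod (\<O> k X - permanent k X))\<^sup>2 \<le> \<delta>\<^sup>2 * fact k"
  shows "1 - c \<le> PTest_accept_prob \<O> n \<delta> c"
proof -
  have "\<delta> * c \<le> 1 * 1"
    using \<delta> c by (intro mult_mono) auto
  then have nonneg: "0 \<le> ln (1 / (\<delta> * c))"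
    using \<delta> c by simp
  have "4 * sqrt (ln (1 / (\<delta> * c))) \<le> C * sqrt (ln (1 / (\<delta> * c)))"
    using C nonneg by (intro mult_right_mono) auto
  then have "4 * sqrt (ln (1 / (\<delta> * c))) \<le> real n"
    using large by linarith
  from ln_le_of_sqrt_bound[OF this _ nonneg]
  have "ln (1 / (\<delta> * c)) \<le> (real n)\<^sup>2 / 16"
    by simp
  then have "real (PTest_reps n \<delta> c) * (\<Sum>k=1..n. 2 ^ k * exp (- (real n - 1)\<^sup>2 / 2)) \<le> 1 / 4 * c"
    using n by (intro linearity_failure_le \<delta> c small) auto
  moreover have "real (PTest_reps n \<delta> c) * (\<Sum>k=1..n. (real k + 1) / (PTest_threshold n \<delta> c - 1) ^ 4) \<le> 3 / 4 * c"
    by (intro tail_failure_le n \<delta> c)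
  ultimately show ?thesis
    using PTest_accept_prob_ge_union_bound[OF near \<delta> c]
    unfolding sum.distrib distrib_left by linarith
qed

theorem mainTheorem2:
  shows "\<exists>C::real. C > 0 \<and>
    (\<forall>(n::nat) (\<delta>::real) (c::real) (\<O> :: nat \<Rightarrow> cmatrix \<Rightarrow> complex).
       0 < \<delta> \<and> \<delta> \<le> 1 \<and> 0 < c \<and> c \<le> 1 \<and>
       real n \<ge> C * sqrt (ln (1 / (\<delta> * c))) \<and>
       (\<forall>k\<in>{1..n}. \<forall>X\<in>cmatrices k. (cmod (\<O> k X - permanent k X))\<^sup>2 \<le> \<delta>\<^sup>2 * fact k)
       \<longrightarrow> PTest_accept_prob \<O> n \<delta> c \<ge> 1 - c)"
proof -
  let ?good = "\<lambda>C n. \<forall>\<delta> c \<O>. 0 < \<delta> \<and> \<delta> \<le> 1 \<and> 0 < c \<and> c \<le> 1 \<and>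
       real n \<ge> C * sqrt (ln (1 / (\<delta> * c))) \<and>
       (\<forall>k\<in>{1..n}. \<forall>X\<in>cmatrices k. (cmod (\<O> k X - permanent k X))\<^sup>2 \<le> \<delta>\<^sup>2 * fact k)
       \<longrightarrow> PTest_accept_prob \<O> n \<delta> c \<ge> 1 - c"
  obtain N where N: "\<And>n. N \<le> n \<Longrightarrow>
      193 * real n ^ 3 * 2 ^ n * exp ((real n)\<^sup>2 / 4 - (real n - 1)\<^sup>2 / 2) \<le> 1 / 4"
    using eventually_linearity_failure_small unfolding eventually_at_top_linorder by blast
  \<comment> \<open>\<open>N\<close> does not depend on \<open>C\<close>, so only finitely many
    requirements on \<open>C\<close> remain and can be met together.\<close>
  have "\<forall>\<^sub>F C in at_top. \<forall>n\<in>{1..max N 10}. ?good C n"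
    by (intro eventually_ball_finite ballI PTest_accept_prob_fixed_n) auto
  then have "\<forall>\<^sub>F C in at_top. (\<forall>n\<in>{1..max N 10}. ?good C n) \<and> 4 \<le> C"
    using eventually_ge_at_top[of 4] by (rule eventually_conj)
  then have "\<exists>C. (\<forall>n\<in>{1..max N 10}. ?good C n) \<and> 4 \<le> C"
    by (rule eventually_happens'[OF trivial_limit_at_top_linorder])
  then obtain C where C': "(\<forall>n\<in>{1..max N 10}. ?good C n) \<and> 4 \<le> C" ..
  note small = bspec[OF conjunct1[OF C']] and C = conjunct2[OF C']
  have "?good C n" for n
  proof (cases "n \<in> {1..max N 10}")
    case True
    then show ?thesis by (rule small)
  next
    case False
    then consider "n = 0" | "N \<le> n" "10 \<le> n" by force
    then show ?thesis
    proof cases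
      \<comment> \<open>Without dimensions to test, the sum in the union bound is empty and the
        bound is 1.\<close>
      case 1
      show ?thesis
      proof (intro allI impI, elim conjE)
        fix \<delta> c :: real and \<O> :: "nat \<Rightarrow> cmatrix \<Rightarrow> complex"
        assume \<delta>: "0 < \<delta>" "\<delta> \<le> 1" and c: "0 < c" "c \<le> 1"
          and near: "\<forall>k\<in>{1..n}. \<forall>X\<in>cmatrices k. (cmod (\<O> k X - permanent k X))\<^sup>2 \<le> \<delta>\<^sup>2 * fact k"
        show "1 - c \<le> PTest_accept_prob \<O> n \<delta> c"
          using PTest_accept_prob_ge_union_bound[OF near \<delta> c] c 1 by simp
      qed
    next
      case 2
      show ?thesis
      proof (intro allI impI, elim conjE)
        fix \<delta> c :: real and \<O> :: "nat \<Rightarrow> cmatrix \<Rightarrow> complex"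
        assume "0 < \<delta>" "\<delta> \<le> 1" "0 < c" "c \<le> 1" "C * sqrt (ln (1 / (\<delta> * c))) \<le> real n"
          "\<forall>k\<in>{1..n}. \<forall>X\<in>cmatrices k. (cmod (\<O> k X - permanent k X))\<^sup>2 \<le> \<delta>\<^sup>2 * fact k"
        then show "1 - c \<le> PTest_accept_prob \<O> n \<delta> c"
          by (rule PTest_accept_prob_large_n[OF 2(2) C N[OF 2(1)]])
      qed
    qed
  qed
  then have "\<forall>n. ?good C n" ..
  moreover have "0 < C" using C by linarith
  ultimately show ?thesis by (intro exI[of _ C] conjI)
qed

end
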